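(* For every integer $n\ge 1$, the reduced (integral) homology of the clique complex $K_n$ of the partition graph $G_n$ is concentrated in degree $2$, and $\widetilde H_2(K_n)\cong\mathbb Z^{\,\chi(K_n)-1}$. Equivalently, $\widetilde H_i(K_n)=0$ for $i\ne 2$ and $\operatorname{rank}\widetilde H_2(K_n)=\chi(K_n)-1$, where $\chi$ denotes the Euler characteristic.
   Context: A partition of a positive integer $n$ is a weakly decreasing sequence $\lambda=(\lambda_1\ge\cdots\ge\lambda_\ell>0)$ of positive integers with sum $n$; it is identified with its Ferrers diagram, the left-justified array with $\lambda_i$ cells in row $i$. The partition graph $G_n$ is the simple graph whose vertices are all partitions of $n$; two distinct partitions are adjacent if one can be obtained from the other by removing one cell from a row of the Ferrers diagram, adding it to another row (possibly a new row, i.e. a row of length $0$), and then reordering the row lengths into weakly decreasing order (discarding zeros). $K_n:=\mathrm{Cl}(G_n)$ is the clique complex of $G_n$: the simplicial complex whose simplices are the finite nonempty cliques of $G_n$. *)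

theory Defs
  imports
    "HOL-Algebra.Free_Abelian_Groups"
    "HOL-Library.List_Lexorder"
    "HOL-Library.Extended_Nat"
begin

section \<open>The partition graph\<close>

definition integer_partitions :: "nat \<Rightarrow> nat list set" where
  "integer_partitions n =
     {xs. sorted_wrt (\<ge>) xs \<and> (\<forall>x \<in> set xs. 0 < x) \<and> sum_list xs = n}"

definition normalize_rows :: "nat list \<Rightarrow> nat list" where
  "normalize_rows xs = rev (sort (filter (\<lambda>k. 0 < k) xs))"

text \<open>One cell is moved from row \<open>i\<close> to another row \<open>j\<close> (rows numbered from 0). The row of
  length 0 appended at index \<open>length xs\<close> is the possible new row.\<close>

definition move_cell :: "nat \<Rightarrow> nat \<Rightarrow> nat list \<Rightarrow> nat list" where
  "move_cell i j xs =
     (let ys = xs @ [0] in normalize_rows (ys[i := ys ! i - 1, j := ys ! j + 1]))"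

definition cell_move :: "nat list \<Rightarrow> nat list \<Rightarrow> bool" where
  "cell_move xs ys \<longleftrightarrow>
     (\<exists>i j. i < length xs \<and> j \<le> length xs \<and> i \<noteq> j \<and> ys = move_cell i j xs)"

definition partition_adj :: "nat list \<Rightarrow> nat list \<Rightarrow> bool" where
  "partition_adj xs ys \<longleftrightarrow> xs \<noteq> ys \<and> (cell_move xs ys \<or> cell_move ys xs)"


section \<open>Clique complexes\<close>

text \<open>An abstract simplicial complex is represented by the set of its (finite, nonempty)
  simplices.\<close>

definition clique_complex :: "'a set \<Rightarrow> ('a \<Rightarrow> 'a \<Rightarrow> bool) \<Rightarrow> 'a set set" where
  "clique_complex V adj =
     {s. finite s \<and> s \<noteq> {} \<and> s \<subseteq> V \<and> (\<forall>u \<in> s. \<forall>v \<in> s. u \<noteq> v \<longrightarrow> adj u v)}"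

definition partition_complex :: "nat \<Rightarrow> nat list set set" where
  "partition_complex n = clique_complex (integer_partitions n) partition_adj"

text \<open>A simplex \<open>s\<close> has dimension \<open>card s - 1\<close>. The definition is meant for finite complexes.\<close>

definition complex_euler_char :: "'a set set \<Rightarrow> int" where
  "complex_euler_char K = (\<Sum>s \<in> K. (-1) ^ (card s - 1))"


section \<open>Reduced integral simplicial homology\<close>

text \<open>The augmented chain complex has the empty simplex as its only generator in degree -1.
  Simplices are oriented by the ambient linear order on the vertices; the homology groups do not
  depend on this order up to isomorphism.\<close>

definition reduced_simplices :: "int \<Rightarrow> 'a set set \<Rightarrow> 'a set set" where
  "reduced_simplices p K = {s \<in> insert {} K. int (card s) = p + 1}"

definition reduced_chain_group :: "int \<Rightarrow> 'a set set \<Rightarrow> ('a set \<Rightarrow>\<^sub>0 int) monoid" where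
  "reduced_chain_group p K = free_Abelian_group (reduced_simplices p K)"

text \<open>The exponent of the sign is the position of \<open>v\<close> in the increasing enumeration of the
  vertices of \<open>s\<close>, starting from 0. In degree 0 this is the augmentation.\<close>

definition face_boundary :: "'a::linorder set \<Rightarrow> ('a set \<Rightarrow>\<^sub>0 int)" where
  "face_boundary s =
     (\<Sum>v \<in> s. frag_cmul ((-1) ^ card {u \<in> s. u < v}) (frag_of (s - {v})))"

definition reduced_boundary :: "('a::linorder set \<Rightarrow>\<^sub>0 int) \<Rightarrow> ('a set \<Rightarrow>\<^sub>0 int)" where
  "reduced_boundary c = frag_extend face_boundary c"

definition reduced_cycles :: "int \<Rightarrow> 'a::linorder set set \<Rightarrow> ('a set \<Rightarrow>\<^sub>0 int) set" where
  "reduced_cycles p K = {c \<in> carrier (reduced_chain_group p K). reduced_boundary c = 0}"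

definition reduced_boundaries :: "int \<Rightarrow> 'a::linorder set set \<Rightarrow> ('a set \<Rightarrow>\<^sub>0 int) set" where
  "reduced_boundaries p K = reduced_boundary ` carrier (reduced_chain_group (p + 1) K)"

definition reduced_simplicial_homology ::
    "int \<Rightarrow> 'a::linorder set set \<Rightarrow> ('a set \<Rightarrow>\<^sub>0 int) set monoid" where
  "reduced_simplicial_homology p K =
     subgroup_generated (reduced_chain_group p K) (reduced_cycles p K) Mod reduced_boundaries p K"


section \<open>Rank of an abelian group\<close>

definition int_independent :: "('a, 'b) monoid_scheme \<Rightarrow> 'a set \<Rightarrow> bool" where
  "int_independent G S \<longleftrightarrow> finite S \<and> S \<subseteq> carrier G \<and>
     (\<forall>c :: 'a \<Rightarrow> int.
        finprod G (\<lambda>x. x [^]\<^bsub>G\<^esub> c x) S = \<one>\<^bsub>G\<^esub> \<longrightarrow> (\<forall>x \<in> S. c x = 0))"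

definition abelian_rank :: "('a, 'b) monoid_scheme \<Rightarrow> enat" where
  "abelian_rank G = (SUP S \<in> {S. int_independent G S}. enat (card S))"

end

theory Submission
  imports Defs
begin

text \<open>
  Two partitions are adjacent iff their diagrams, as sets of cells, share all cells but one. Hence
  a clique with at least three elements either consists of diagrams containing a common diagram of
  size \<open>n - 1\<close> or of diagrams contained in a common diagram of size \<open>n + 1\<close>, and not both. The
  maximal simplices of these two kinds are the blocks, and two blocks of the same kind share at
  most one vertex.

  Coning off inside the blocks kills the homology in degrees at least 3. A 2-cycle splits into its
  parts in the two kinds of blocks; their boundaries agree up to sign, and this chain of edges
  determines the homology class, so that the second homology embeds into the group of 1-chains
  and is free.

  For the first homology, the map sending an edge to its class modulo boundaries is a cocycle with
  values in the quotient group, and it suffices that it is a coboundary. By induction on \<open>n\<close>: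
  the cocycle has a potential on each clique of diagrams covering a fixed \<open>N\<close>, and the
  discrepancies of the potentials of \<open>N\<close> and \<open>M\<close> at \<open>N \<union> M\<close> form a cocycle for \<open>n - 1\<close>.
  Connectivity follows in the same way, and the rank comes from the Euler characteristic.
\<close>

section \<open>Free abelian groups of finite rank\<close>

text \<open>Coning stops at degree 2 because of the edges. Two adjacent diagrams lie in one block of
  each kind, those of their intersection and of their union, so an edge can be coned in two ways
  that need not agree. From degree 3 on no facet is an edge; in degree 2 all facets are, and the
  disagreement is what survives as homology. In degree 1 the coefficients have to be the chains
  modulo boundaries. Integral cocycles would not detect torsion in the first homology, whereas a
  potential for the tautological cocycle makes each edge congruent to a difference of two vertex
  terms, and these cancel along any cycle. No quotient is formed: congruence is membership of a
  difference in a subgroup \<open>B\<close>. The induction cannot stay inside one partition graph,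
  so it is carried out for families of finite sets closed under union and intersection in which
  every nonempty member can lose a point. Distinct neighbours on one level then have their union on
  the next level, which is where two local potentials can be compared.\<close>

definition additive_subgroup :: "'g::ab_group_add set \<Rightarrow> bool" where
  "additive_subgroup H \<longleftrightarrow> 0 \<in> H \<and> (\<forall>x \<in> H. \<forall>y \<in> H. x - y \<in> H)"

lemma additive_subgroupI:
  "\<lbrakk>0 \<in> H; \<And>x y. \<lbrakk>x \<in> H; y \<in> H\<rbrakk> \<Longrightarrow> x - y \<in> H\<rbrakk> \<Longrightarrow> additive_subgroup H"
  by (auto simp: additive_subgroup_def)

lemma
  assumes "additive_subgroup H"
  shows additive_subgroup_0: "0 \<in> H"
    and additive_subgroup_diff: "\<lbrakk>x \<in> H; y \<in> H\<rbrakk> \<Longrightarrow> x - y \<in> H"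
    and additive_subgroup_uminus: "x \<in> H \<Longrightarrow> - x \<in> H"
    and additive_subgroup_add: "\<lbrakk>x \<in> H; y \<in> H\<rbrakk> \<Longrightarrow> x + y \<in> H"
proof -
  show 0: "0 \<in> H" and d: "\<lbrakk>x \<in> H; y \<in> H\<rbrakk> \<Longrightarrow> x - y \<in> H" for x y
    using assms by (auto simp: additive_subgroup_def)
  show m: "x \<in> H \<Longrightarrow> - x \<in> H" for x
    using d[OF 0, of x] by simp
  show "\<lbrakk>x \<in> H; y \<in> H\<rbrakk> \<Longrightarrow> x + y \<in> H"
    using d[OF _ m, of x y] by simp
qed

lemma keys_diff_subset:
  "\<lbrakk>Poly_Mapping.keys x \<subseteq> S; Poly_Mapping.keys y \<subseteq> S\<rbrakk> \<Longrightarrow> Poly_Mapping.keys (x - y) \<subseteq> S"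
  using keys_diff[of x y] by blast

lemma additive_subgroup_keys: "additive_subgroup {c :: 'b \<Rightarrow>\<^sub>0 int. Poly_Mapping.keys c \<subseteq> S}"
  by (rule additive_subgroupI) (simp_all add: keys_diff_subset)

lemma frag_extend_in_additive_subgroup:
  assumes "additive_subgroup H" "\<And>x. x \<in> Poly_Mapping.keys c \<Longrightarrow> f x \<in> H"
  shows "frag_extend f c \<in> H"
proof -
  have "Poly_Mapping.keys c \<subseteq> {x. f x \<in> H}" using assms(2) by blast
  then show ?thesis
    by (rule free_Abelian_group_induct)
      (auto simp: frag_extend_diff additive_subgroup_0[OF assms(1)]
        intro: additive_subgroup_diff[OF assms(1)])
qed

text \<open>\<open>f\<close> is additive only on \<open>H\<close>, so the induction over
  \<open>c\<close> has to know that all partial combinations stay in \<open>H\<close>.\<close>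

lemma additive_extends_frag:
  assumes H: "additive_subgroup H"
    and f: "\<And>x y. \<lbrakk>x \<in> H; y \<in> H\<rbrakk> \<Longrightarrow> f (x - y) = f x - (f y :: 'c \<Rightarrow>\<^sub>0 int)"
    and b: "\<And>i. i \<in> S \<Longrightarrow> b i \<in> H"
    and c: "Poly_Mapping.keys c \<subseteq> S"
  shows "f (frag_extend b c) = frag_extend (f \<circ> b) c"
proof -
  have f0: "f 0 = 0" using f[of 0 0] additive_subgroup_0[OF H] by simp
  have mem: "frag_extend b x \<in> H" if "Poly_Mapping.keys x \<subseteq> S" for x
    by (rule frag_extend_in_additive_subgroup[OF H]) (use b that in auto)
  show ?thesis
    by (rule free_Abelian_group_induct[OF c]) (auto simp: f0 frag_extend_diff f mem)
qed

text \<open>A basis is kept as a map \<open>b\<close> on the indices below \<open>r\<close>, and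
  freeness as bijectivity of forming integer combinations. Working with plain sets of chains keeps
  kernels and images free of group records.\<close>

definition free_of_rank :: "('b \<Rightarrow>\<^sub>0 int) set \<Rightarrow> nat \<Rightarrow> bool" where
  "free_of_rank H r \<longleftrightarrow> (\<exists>b. bij_betw (frag_extend b) {c. Poly_Mapping.keys c \<subseteq> {..<r}} H)"

lemma free_of_rank_bij_betw:
  assumes "free_of_rank H r" and H: "additive_subgroup H"
    and f: "\<And>x y. \<lbrakk>x \<in> H; y \<in> H\<rbrakk> \<Longrightarrow> f (x - y) = f x - f y" and bij: "bij_betw f H H'"
  shows "free_of_rank H' r"
proof -
  obtain b where b: "bij_betw (frag_extend b) {c. Poly_Mapping.keys c \<subseteq> {..<r}} H"
    using assms(1) by (auto simp: free_of_rank_def)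
  have bH: "b i \<in> H" if "i < r" for i
    using bij_betwE[OF b] that by (metis frag_extend_of keys_frag_of lessThan_iff mem_Collect_eq singletonD subsetI)
  have "bij_betw (f \<circ> frag_extend b) {c. Poly_Mapping.keys c \<subseteq> {..<r}} H'"
    by (rule bij_betw_trans[OF b bij])
  moreover have "(f \<circ> frag_extend b) c = frag_extend (f \<circ> b) c"
    if "c \<in> {c. Poly_Mapping.keys c \<subseteq> {..<r}}" for c
    using additive_extends_frag[OF H f, of "{..<r}" b c] bH that by auto
  ultimately show ?thesis
    unfolding free_of_rank_def by (metis (no_types, lifting) bij_betw_cong)
qed

lemma bij_betw_frag_extend_frag_of:
  assumes "bij_betw f A B"
  shows "bij_betw (frag_extend (frag_of \<circ> f)) {c. Poly_Mapping.keys c \<subseteq> A} {c. Poly_Mapping.keys c \<subseteq> B}"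
proof (rule bij_betw_byWitness[where f' = "frag_extend (frag_of \<circ> inv_into A f)"])
  have *: "frag_extend (frag_of \<circ> g) c = c"
    if "\<And>x. x \<in> Poly_Mapping.keys c \<Longrightarrow> g x = x" for g and c :: "'x \<Rightarrow>\<^sub>0 int"
  proof -
    have "frag_extend (frag_of \<circ> g) c = frag_extend frag_of c"
      by (rule frag_extend_eq) (simp add: that)
    then show ?thesis by (simp flip: frag_expansion)
  qed
  show "\<forall>a\<in>{c. Poly_Mapping.keys c \<subseteq> A}.
       frag_extend (frag_of \<circ> inv_into A f) (frag_extend (frag_of \<circ> f) a) = a"
    using bij_betw_inv_into_left[OF assms]
    by (auto simp: frag_extend_compose comp_assoc intro!: *)
  show "\<forall>a\<in>{c. Poly_Mapping.keys c \<subseteq> B}.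
       frag_extend (frag_of \<circ> f) (frag_extend (frag_of \<circ> inv_into A f) a) = a"
    using bij_betw_inv_into_right[OF assms]
    by (auto simp: frag_extend_compose comp_assoc intro!: *)
  show "frag_extend (frag_of \<circ> f) ` {c. Poly_Mapping.keys c \<subseteq> A} \<subseteq> {c. Poly_Mapping.keys c \<subseteq> B}"
    using bij_betwE[OF assms] by (fastforce dest: subsetD[OF keys_frag_extend])
  show "frag_extend (frag_of \<circ> inv_into A f) ` {c. Poly_Mapping.keys c \<subseteq> B} \<subseteq> {c. Poly_Mapping.keys c \<subseteq> A}"
    using bij_betwE[OF bij_betw_inv_into[OF assms]] by (fastforce dest: subsetD[OF keys_frag_extend])
qed

lemma free_of_rank_keys:
  assumes "finite S"
  shows "free_of_rank {c. Poly_Mapping.keys c \<subseteq> S} (card S)"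
proof -
  obtain h where "bij_betw h {..<card S} S"
    using ex_bij_betw_nat_finite[OF assms] by (auto simp: atLeast0LessThan)
  then show ?thesis
    unfolding free_of_rank_def using bij_betw_frag_extend_frag_of by blast
qed

lemma free_of_rank_zero: "free_of_rank {0} 0"
  unfolding free_of_rank_def by (rule exI[of _ "\<lambda>_. 0"]) (auto simp: bij_betw_def)

lemma free_of_rank_iso:
  assumes "bij_betw (frag_extend b) {c. Poly_Mapping.keys c \<subseteq> S} H"
  shows "frag_extend b \<in> iso (free_Abelian_group S) \<lparr>carrier = H, mult = (+), one = 0\<rparr>"
  using assms
  by (auto simp: iso_def hom_def frag_extend_add free_Abelian_group_def bij_betw_def)

lemma free_of_rank_unique:
  assumes "free_of_rank H r" "free_of_rank H s"
  shows "r = s"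
proof -
  let ?M = "\<lparr>carrier = H, mult = (+), one = 0\<rparr>"
  have "free_Abelian_group {..<r} \<cong> ?M" "free_Abelian_group {..<s} \<cong> ?M"
    using assms free_of_rank_iso unfolding free_of_rank_def is_iso_def by blast+
  then have "free_Abelian_group {..<r} \<cong> free_Abelian_group {..<s}"
    by (meson group.iso_sym group_free_Abelian_group iso_trans)
  then show ?thesis
    by (simp add: isomorphic_free_Abelian_groups eqpoll_iff_card)
qed

text \<open>Shifting the second family of coordinates by \<open>s\<close> numbers both families by
  one initial segment. A basis of an image and a basis of a kernel are merged this way.\<close>

lemma bij_betw_frag_concat:
  fixes s k :: nat
  shows "bij_betw (\<lambda>(c, d). c + frag_extend (\<lambda>i. frag_of (s + i)) d)
    ({c. Poly_Mapping.keys c \<subseteq> {..<s}} \<times> {c. Poly_Mapping.keys c \<subseteq> {..<k}})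
    {c. Poly_Mapping.keys c \<subseteq> {..<s + k}}"
    (is "bij_betw ?j (?P \<times> ?Q) ?R")
proof -
  let ?g = "\<lambda>i::nat. s + i"
  have sh: "bij_betw (frag_extend (frag_of \<circ> ?g)) ?Q {c. Poly_Mapping.keys c \<subseteq> {s..<s + k}}"
    by (rule bij_betw_frag_extend_frag_of, rule bij_betw_byWitness[where f' = "\<lambda>i. i - s"]) auto
  have "bij_betw (\<lambda>(c, d). c + d) (?P \<times> {c. Poly_Mapping.keys c \<subseteq> {s..<s + k}}) ?R"
    unfolding bij_betw_def
  proof (intro conjI subset_antisym)
    show "inj_on (\<lambda>(c::nat \<Rightarrow>\<^sub>0 int, d). c + d) (?P \<times> {c. Poly_Mapping.keys c \<subseteq> {s..<s + k}})"
    proof (rule inj_onI, clarsimp)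
      fix a b c d :: "nat \<Rightarrow>\<^sub>0 int"
      assume k: "Poly_Mapping.keys a \<subseteq> {..<s}" "Poly_Mapping.keys b \<subseteq> {s..<s + k}"
          "Poly_Mapping.keys c \<subseteq> {..<s}" "Poly_Mapping.keys d \<subseteq> {s..<s + k}" and eq: "a + b = c + d"
      \<comment> \<open>The two sides have disjoint supports, hence both are zero.\<close>
      from eq have "a - c = d - b" by (simp add: algebra_simps)
      moreover have "Poly_Mapping.keys (a - c) \<subseteq> {..<s}" "Poly_Mapping.keys (d - b) \<subseteq> {s..<s + k}"
        using k by (auto dest!: subsetD[OF keys_diff])
      ultimately have "Poly_Mapping.keys (a - c) = {}" by fastforce
      then show "a = c \<and> b = d" using eq by auto
    qed
    show "?R \<subseteq> (\<lambda>(c, d). c + d) ` (?P \<times> {c. Poly_Mapping.keys c \<subseteq> {s..<s + k}})"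
    proof
      fix c :: "nat \<Rightarrow>\<^sub>0 int" assume "c \<in> ?R"
      then have "Poly_Mapping.keys c \<subseteq> {..<s} \<union> {s..<s + k}" by auto
      then obtain d e where "Poly_Mapping.keys d \<subseteq> {..<s}" "Poly_Mapping.keys e \<subseteq> {s..<s + k}" "d + e = c"
        by (rule frag_split)
      then show "c \<in> (\<lambda>(c, d). c + d) ` (?P \<times> {c. Poly_Mapping.keys c \<subseteq> {s..<s + k}})" by force
    qed
  qed (fastforce dest!: subsetD[OF keys_add])
  from bij_betw_trans[OF bij_betw_map_prod[OF bij_betw_id sh] this]
  show ?thesis by (rule bij_betw_cong[THEN iffD1, rotated]) (auto simp: comp_def)
qed

text \<open>A basis of the image lifts, and together with a basis of the kernel forms a basis.\<close>

lemma free_of_rank_image_kernel: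
  fixes f :: "('b \<Rightarrow>\<^sub>0 int) \<Rightarrow> ('c \<Rightarrow>\<^sub>0 int)"
  assumes H: "additive_subgroup H"
    and f: "\<And>x y. \<lbrakk>x \<in> H; y \<in> H\<rbrakk> \<Longrightarrow> f (x - y) = f x - f y"
    and im: "free_of_rank (f ` H) s" and ker: "free_of_rank {x \<in> H. f x = 0} k"
  shows "free_of_rank H (s + k)"
proof -
  let ?P = "\<lambda>r::nat. {c :: nat \<Rightarrow>\<^sub>0 int. Poly_Mapping.keys c \<subseteq> {..<r}}"
  obtain p where p: "bij_betw (frag_extend p) (?P s) (f ` H)"
    using im by (auto simp: free_of_rank_def)
  obtain q where q: "bij_betw (frag_extend q) (?P k) {x \<in> H. f x = 0}"
    using ker by (auto simp: free_of_rank_def)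
  have "\<exists>y \<in> H. f y = p i" if "i < s" for i
    using bij_betwE[OF p, rule_format, of "frag_of i"] that by (auto simp: keys_frag_of)
  then obtain l where l: "\<And>i. i < s \<Longrightarrow> l i \<in> H" "\<And>i. i < s \<Longrightarrow> f (l i) = p i" by metis
  have lH: "frag_extend l c \<in> H" if "c \<in> ?P s" for c
    by (rule frag_extend_in_additive_subgroup[OF H]) (use l that in auto)
  have fl: "f (frag_extend l c) = frag_extend p c" if "c \<in> ?P s" for c
  proof -
    have "f (frag_extend l c) = frag_extend (f \<circ> l) c"
      by (rule additive_extends_frag[OF H f]) (use l that in auto)
    also have "\<dots> = frag_extend p c" by (rule frag_extend_eq) (use l that in auto)
    finally show ?thesis .
  qed
  have fadd: "f (x + y) = f x + f y" if "x \<in> H" "y \<in> H" for x y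
  proof -
    have "f 0 = 0" using f[of 0 0] additive_subgroup_0[OF H] by simp
    then have "f (- y) = - f y" using f[of 0 y] additive_subgroup_0[OF H] that by simp
    then show ?thesis using f[of x "- y"] that additive_subgroup_uminus[OF H] by simp
  qed
  have qH: "frag_extend q d \<in> H" "f (frag_extend q d) = 0" if "d \<in> ?P k" for d
    using bij_betwE[OF q] that by auto
  have \<theta>: "bij_betw (\<lambda>(c, d). frag_extend l c + frag_extend q d) (?P s \<times> ?P k) H"
    unfolding bij_betw_def
  proof (intro conjI subset_antisym)
    show "inj_on (\<lambda>(c, d). frag_extend l c + frag_extend q d) (?P s \<times> ?P k)"
    proof (rule inj_onI, clarsimp)
      fix a b c d :: "nat \<Rightarrow>\<^sub>0 int"
      assume m: "Poly_Mapping.keys a \<subseteq> {..<s}" "Poly_Mapping.keys b \<subseteq> {..<k}"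
          "Poly_Mapping.keys c \<subseteq> {..<s}" "Poly_Mapping.keys d \<subseteq> {..<k}"
        and eq: "frag_extend l a + frag_extend q b = frag_extend l c + frag_extend q d"
      from arg_cong[OF eq, of f] m have "frag_extend p a = frag_extend p c"
        by (simp add: fadd lH qH fl)
      with m have "a = c" using bij_betw_imp_inj_on[OF p] by (auto dest: inj_onD)
      with eq have "frag_extend q b = frag_extend q d" by simp
      with m have "b = d" using bij_betw_imp_inj_on[OF q] by (auto dest: inj_onD)
      with \<open>a = c\<close> show "a = c \<and> b = d" by simp
    qed
    show "H \<subseteq> (\<lambda>(c, d). frag_extend l c + frag_extend q d) ` (?P s \<times> ?P k)"
    proof
      fix x assume x: "x \<in> H"
      then obtain c where c: "c \<in> ?P s" "frag_extend p c = f x"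
        using p by (metis (no_types, lifting) bij_betw_imp_surj_on imageE imageI)
      then have "x - frag_extend l c \<in> {x \<in> H. f x = 0}"
        using x lH fl f additive_subgroup_diff[OF H] by simp
      then obtain d where "d \<in> ?P k" "frag_extend q d = x - frag_extend l c"
        using q by (metis (no_types, lifting) bij_betw_imp_surj_on imageE)
      then show "x \<in> (\<lambda>(c, d). frag_extend l c + frag_extend q d) ` (?P s \<times> ?P k)"
        using c by (force intro!: image_eqI[of _ _ "(c, d)"])
    qed
  qed (auto intro!: additive_subgroup_add[OF H] simp: lH qH)
  define b where "b i = (if i < s then l i else q (i - s))" for i
  have eq: "frag_extend b (c + frag_extend (\<lambda>i. frag_of (s + i)) d) = frag_extend l c + frag_extend q d"
    if "c \<in> ?P s" for c d
  proof -
    have "frag_extend b c = frag_extend l c"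
      by (rule frag_extend_eq) (use that in \<open>auto simp: b_def\<close>)
    moreover have "frag_extend b (frag_extend (frag_of \<circ> (\<lambda>i. s + i)) d) = frag_extend q d"
      unfolding frag_extend_compose by (rule frag_extend_eq) (simp add: b_def)
    ultimately show ?thesis by (simp add: frag_extend_add comp_def)
  qed
  have "bij_betw (frag_extend b \<circ> (\<lambda>(c, d). c + frag_extend (\<lambda>i. frag_of (s + i)) d)) (?P s \<times> ?P k) H"
    using \<theta> by (rule bij_betw_cong[THEN iffD1, rotated]) (auto simp: eq)
  then have "bij_betw (frag_extend b) (?P (s + k)) H"
    using bij_betw_comp_iff[OF bij_betw_frag_concat] by blast
  then show ?thesis unfolding free_of_rank_def by blast
qed

section \<open>Subgroups of free abelian groups, and the rank\<close>

lemma int_additive_subgroup_cyclic: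
  fixes I :: "int set"
  assumes "additive_subgroup I"
  obtains d where "I = range (\<lambda>k. k * d)"
proof (cases "I \<subseteq> {0}")
  case True
  then have "I = range (\<lambda>k. k * 0)" using additive_subgroup_0[OF assms] by auto
  then show ?thesis by (rule that)
next
  case False
  then obtain x where x: "x \<in> I" "x \<noteq> 0" by auto
  then have "\<bar>x\<bar> \<in> I" using additive_subgroup_uminus[OF assms] by (auto simp: abs_if)
  then have ex: "int (nat \<bar>x\<bar>) \<in> I \<and> 0 < nat \<bar>x\<bar>" using x by simp
  \<comment> \<open>The least positive element generates: the remainder of any member modulo it lies
    in \<open>I\<close> and is smaller, hence zero.\<close>
  define d where "d = (LEAST d. int d \<in> I \<and> 0 < d)"
  have d: "int d \<in> I" "0 < d" using LeastI[of "\<lambda>d. int d \<in> I \<and> 0 < d", OF ex] by (auto simp: d_def)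
  have nm: "int m * int d \<in> I" for m
    by (induction m) (auto simp: algebra_simps additive_subgroup_0[OF assms] intro!: additive_subgroup_add[OF assms] d)
  have mul: "m * int d \<in> I" for m
    using nm[of "nat m"] additive_subgroup_uminus[OF assms nm[of "nat (- m)"]] by (cases "m \<ge> 0") auto
  have "y \<in> range (\<lambda>k. k * int d)" if "y \<in> I" for y
  proof -
    have "y mod int d \<in> I"
      using additive_subgroup_diff[OF assms that mul[of "y div int d"]] by (simp add: minus_div_mult_eq_mod)
    moreover have "0 \<le> y mod int d" "y mod int d < int d" using d by auto
    ultimately have "y mod int d = 0"
      using not_less_Least[of "nat (y mod int d)" "\<lambda>d. int d \<in> I \<and> 0 < d"]
      by (fold d_def) (auto simp: nat_less_iff)
    then have "y = (y div int d) * int d" by auto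
    then show ?thesis by blast
  qed
  then have "I = range (\<lambda>k. k * int d)" using mul by auto
  then show ?thesis by (rule that)
qed

text \<open>Induction on the number of coordinates: the last coordinate maps \<open>H\<close> onto a
  cyclic group of integers, of rank at most one, and the kernel lives in one coordinate less. The
  bound on \<open>s\<close> is what later limits the size of independent sets.\<close>

lemma free_of_rank_subgroup_nat:
  assumes "additive_subgroup H" "H \<subseteq> {c. Poly_Mapping.keys c \<subseteq> {..<r::nat}}"
  shows "\<exists>s \<le> r. free_of_rank H s"
  using assms
proof (induction r arbitrary: H)
  case 0
  then have "H = {0}" using additive_subgroup_0 by auto
  then show ?case using free_of_rank_zero by auto
next
  case (Suc r)
  \<comment> \<open>The integer coordinate is packaged as a multiple of a single generator, because
    \<open>free_of_rank\<close> speaks about such combinations.\<close>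
  define f :: "(nat \<Rightarrow>\<^sub>0 int) \<Rightarrow> (unit \<Rightarrow>\<^sub>0 int)"
    where "f c = frag_cmul (Poly_Mapping.lookup c r) (frag_of ())" for c
  have f: "f (x - y) = f x - f y" for x y by (simp add: f_def lookup_minus frag_cmul_diff_distrib)
  let ?I = "(\<lambda>c. Poly_Mapping.lookup c r) ` H"
  have "additive_subgroup ?I"
  proof (rule additive_subgroupI)
    show "0 \<in> ?I" using additive_subgroup_0[OF Suc.prems(1)] by force
    show "x - y \<in> ?I" if xy: "x \<in> ?I" "y \<in> ?I" for x y
    proof -
      obtain a b where "a \<in> H" "b \<in> H" "x = Poly_Mapping.lookup a r" "y = Poly_Mapping.lookup b r"
        using xy by auto
      then show ?thesis using additive_subgroup_diff[OF Suc.prems(1), of a b]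
        by (force simp: lookup_minus)
    qed
  qed
  then obtain d where d: "?I = range (\<lambda>k. k * d)" by (rule int_additive_subgroup_cyclic)
  have fH: "f ` H = range (\<lambda>k. frag_cmul (k * d) (frag_of ()))"
  proof -
    have "f ` H = (\<lambda>k. frag_cmul k (frag_of ())) ` ?I" by (simp add: f_def image_image)
    then show ?thesis unfolding d by (simp add: image_image)
  qed
  have im: "\<exists>s \<le> 1. free_of_rank (f ` H) s"
  proof (cases "d = 0")
    case True
    then have "f ` H = {0}" by (simp add: fH)
    then show ?thesis using free_of_rank_zero by auto
  next
    case False
    have "bij_betw (frag_cmul d) {c. Poly_Mapping.keys c \<subseteq> {()}} (f ` H)"
      unfolding bij_betw_def
    proof
      show "inj_on (frag_cmul d) {c. Poly_Mapping.keys c \<subseteq> {()}}"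
      proof (rule inj_onI)
        fix a b :: "unit \<Rightarrow>\<^sub>0 int" assume "frag_cmul d a = frag_cmul d b"
        then have "d * Poly_Mapping.lookup a i = d * Poly_Mapping.lookup b i" for i
          by (metis lookup_frag_cmul)
        then show "a = b" using False by (intro poly_mapping_eqI) auto
      qed
      have "c = frag_cmul (Poly_Mapping.lookup c ()) (frag_of ())" for c :: "unit \<Rightarrow>\<^sub>0 int"
        by (rule poly_mapping_eqI) simp
      then have R: "range (\<lambda>k. frag_cmul k (frag_of ())) = (UNIV :: (unit \<Rightarrow>\<^sub>0 int) set)" by blast
      have K: "{c :: unit \<Rightarrow>\<^sub>0 int. Poly_Mapping.keys c \<subseteq> {()}} = UNIV" by auto
      have "f ` H = frag_cmul d ` range (\<lambda>k. frag_cmul k (frag_of ()))"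
        unfolding fH by (simp add: image_image mult.commute)
      then show "frag_cmul d ` {c. Poly_Mapping.keys c \<subseteq> {()}} = f ` H"
        by (simp only: R K)
    qed
    then have "free_of_rank (f ` H) (card {()})"
      by (rule free_of_rank_bij_betw[OF free_of_rank_keys additive_subgroup_keys, rotated 2])
        (auto intro!: poly_mapping_eqI simp: lookup_minus right_diff_distrib)
    then show ?thesis by auto
  qed
  have "additive_subgroup {x \<in> H. f x = 0}"
    using additive_subgroup_0[OF Suc.prems(1)] additive_subgroup_diff[OF Suc.prems(1)]
    by (intro additive_subgroupI) (auto simp: f f_def[of 0])
  moreover have "{x \<in> H. f x = 0} \<subseteq> {c. Poly_Mapping.keys c \<subseteq> {..<r}}"
  proof clarify
    fix c i assume c: "c \<in> H" "f c = 0" "i \<in> Poly_Mapping.keys c"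
    then have "Poly_Mapping.keys c \<subseteq> {..<Suc r}" using Suc.prems(2) by blast
    then have "i < Suc r" "i \<noteq> r" using c by (auto simp: f_def in_keys_iff)
    then show "i < r" by simp
  qed
  ultimately obtain k where "k \<le> r" "free_of_rank {x \<in> H. f x = 0} k" using Suc.IH by blast
  moreover obtain s where "s \<le> 1" "free_of_rank (f ` H) s" using im by blast
  ultimately show ?case
    using free_of_rank_image_kernel[OF Suc.prems(1) f] by (intro exI[of _ "s + k"]) auto
qed

lemma free_of_rank_subgroup:
  assumes K: "free_of_rank K r" "additive_subgroup K" and H: "additive_subgroup H" "H \<subseteq> K"
  shows "\<exists>s \<le> r. free_of_rank H s"
proof -
  let ?P = "{c :: nat \<Rightarrow>\<^sub>0 int. Poly_Mapping.keys c \<subseteq> {..<r}}"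
  obtain b where b: "bij_betw (frag_extend b) ?P K"
    using K by (auto simp: free_of_rank_def)
  let ?H = "{c \<in> ?P. frag_extend b c \<in> H}"
  have sub: "additive_subgroup ?H"
    using additive_subgroup_keys[of "{..<r}"] H(1)
    by (intro additive_subgroupI)
      (auto simp: frag_extend_diff additive_subgroup_0 additive_subgroup_diff dest: subsetD[OF keys_diff])
  have "frag_extend b ` ?H = H"
  proof
    show "H \<subseteq> frag_extend b ` ?H"
    proof
      fix x assume x: "x \<in> H"
      then obtain c where "c \<in> ?P" "x = frag_extend b c"
        using H(2) bij_betw_imp_surj_on[OF b] by blast
      then show "x \<in> frag_extend b ` ?H" using x by blast
    qed
  qed auto
  then have "bij_betw (frag_extend b) ?H H"
    using bij_betw_imp_inj_on[OF b] by (auto simp: bij_betw_def intro: inj_on_subset)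
  moreover obtain s where "s \<le> r" "free_of_rank ?H s"
    using free_of_rank_subgroup_nat[OF sub] by blast
  ultimately show ?thesis
    using free_of_rank_bij_betw[OF _ sub, of _ "frag_extend b"] frag_extend_diff by blast
qed

text \<open>Independence of \<open>S\<close> makes the combinations of the images \<open>h x\<close>
  unique, so they form a group of rank \<open>card S\<close> inside one of rank \<open>r\<close>;
  uniqueness of ranks gives \<open>card S \<le> r\<close>. Preimages of the standard basis attain
  the bound.\<close>

lemma abelian_rank_iso_free_Abelian_group:
  assumes G: "comm_group G" and iso: "G \<cong> free_Abelian_group {..<r::nat}"
  shows "abelian_rank G = enat r"
proof -
  let ?F = "free_Abelian_group {..<r}"
  interpret G: comm_group G by (rule G)
  interpret F: comm_group ?F by (rule abelian_free_Abelian_group)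
  obtain h where h: "h \<in> hom G ?F" and bij: "bij_betw h (carrier G) (carrier ?F)"
    using iso by (auto simp: is_iso_def iso_def)
  interpret h: group_hom G ?F h by unfold_locales (rule h)
  have keys: "Poly_Mapping.keys (h x) \<subseteq> {..<r}" if "x \<in> carrier G" for x
    using h.hom_closed[OF that] by simp
  have hprod: "h (finprod G (\<lambda>x. x [^]\<^bsub>G\<^esub> c x) S) = (\<Sum>x \<in> S. frag_cmul (c x) (h x))"
    if "finite S" "S \<subseteq> carrier G" for c :: "_ \<Rightarrow> int" and S
    using that
  proof (induction S rule: finite_induct)
    case (insert x S)
    have "finprod G (\<lambda>x. x [^]\<^bsub>G\<^esub> c x) S \<in> carrier G"
      using insert.prems by (intro G.finprod_closed) auto
    moreover have "h (x [^]\<^bsub>G\<^esub> c x) = frag_cmul (c x) (h x)"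
      using insert.prems keys by (simp add: hom_int_pow[OF h])
    ultimately show ?case
      using insert by (simp add: Pi_iff subset_iff)
  qed (simp add: h.hom_one[simplified])
  have indep: "int_independent G S \<longleftrightarrow> finite S \<and> S \<subseteq> carrier G \<and>
      (\<forall>c. (\<Sum>x \<in> S. frag_cmul (c x) (h x)) = 0 \<longrightarrow> (\<forall>x \<in> S. c x = 0))" for S
  proof -
    have "finprod G (\<lambda>x. x [^]\<^bsub>G\<^esub> c x) S = \<one>\<^bsub>G\<^esub> \<longleftrightarrow> (\<Sum>x \<in> S. frag_cmul (c x) (h x)) = 0"
      if "finite S" "S \<subseteq> carrier G" for c :: "_ \<Rightarrow> int"
    proof -
      have "finprod G (\<lambda>x. x [^]\<^bsub>G\<^esub> c x) S \<in> carrier G"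
        using that by (intro G.finprod_closed) auto
      then have "finprod G (\<lambda>x. x [^]\<^bsub>G\<^esub> c x) S = \<one>\<^bsub>G\<^esub>
          \<longleftrightarrow> h (finprod G (\<lambda>x. x [^]\<^bsub>G\<^esub> c x) S) = h \<one>\<^bsub>G\<^esub>"
        by (metis G.one_closed bij bij_betw_imp_inj_on inj_on_eq_iff)
      then show ?thesis using hprod[OF that] h.hom_one by simp
    qed
    then show ?thesis unfolding int_independent_def by blast
  qed
  have le: "card S \<le> r" if S: "int_independent G S" for S
  proof -
    have fin: "finite S" and sub: "S \<subseteq> carrier G" using S indep by auto
    obtain e where e: "bij_betw e {..<card S} S"
      using ex_bij_betw_nat_finite[OF fin] by (auto simp: atLeast0LessThan)
    let ?P = "{c. Poly_Mapping.keys c \<subseteq> {..<card S}}"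
    have expand: "frag_extend (h \<circ> e) c = (\<Sum>x \<in> S. frag_cmul (Poly_Mapping.lookup c (inv_into {..<card S} e x)) (h x))"
      if "c \<in> ?P" for c
    proof -
      have "frag_extend (h \<circ> e) c = (\<Sum>i<card S. frag_cmul (Poly_Mapping.lookup c i) (h (e i)))"
        unfolding frag_extend_def using that
        by (intro sum.mono_neutral_cong_left) (auto simp: in_keys_iff)
      also have "\<dots> = (\<Sum>i<card S. frag_cmul (Poly_Mapping.lookup c (inv_into {..<card S} e (e i))) (h (e i)))"
        using bij_betw_inv_into_left[OF e] by (intro sum.cong) auto
      also have "\<dots> = (\<Sum>x \<in> S. frag_cmul (Poly_Mapping.lookup c (inv_into {..<card S} e x)) (h x))"
        by (rule sum.reindex_bij_betw[OF e])
      finally show ?thesis .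
    qed
    have inj0: "c = 0" if c: "c \<in> ?P" "frag_extend (h \<circ> e) c = 0" for c
    proof -
      have "\<forall>x\<in>S. Poly_Mapping.lookup c (inv_into {..<card S} e x) = 0"
        using S c expand[OF c(1)] unfolding indep by metis
      then have "Poly_Mapping.lookup c i = 0" if "i < card S" for i
        using bij_betwE[OF e] bij_betw_inv_into_left[OF e] that by (metis lessThan_iff)
      moreover have "Poly_Mapping.lookup c i = 0" if "\<not> i < card S" for i
        using c(1) that by (auto simp: in_keys_iff)
      ultimately show "c = 0" by (intro poly_mapping_eqI) (metis lookup_zero)
    qed
    have "inj_on (frag_extend (h \<circ> e)) ?P"
    proof (rule inj_onI)
      fix a b assume "a \<in> ?P" "b \<in> ?P" "frag_extend (h \<circ> e) a = frag_extend (h \<circ> e) b"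
      then have "a - b = 0"
        by - (rule inj0, simp_all add: frag_extend_diff keys_diff_subset)
      then show "a = b" by simp
    qed
    then have im: "free_of_rank (frag_extend (h \<circ> e) ` ?P) (card S)"
      unfolding free_of_rank_def bij_betw_def by blast
    have "frag_extend (h \<circ> e) ` ?P \<subseteq> {c. Poly_Mapping.keys c \<subseteq> {..<r}}"
    proof clarify
      fix c i assume c: "Poly_Mapping.keys c \<subseteq> {..<card S}"
        and "i \<in> Poly_Mapping.keys (frag_extend (h \<circ> e) c)"
      then obtain j where "j \<in> Poly_Mapping.keys c" "i \<in> Poly_Mapping.keys (h (e j))"
        using keys_frag_extend by fastforce
      then show "i < r" using c keys sub bij_betwE[OF e] by blast
    qed
    moreover have "additive_subgroup (frag_extend (h \<circ> e) ` ?P)"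
    proof (rule additive_subgroupI)
      show "0 \<in> frag_extend (h \<circ> e) ` ?P" by (rule image_eqI[of _ _ 0]) auto
      fix x y assume "x \<in> frag_extend (h \<circ> e) ` ?P" "y \<in> frag_extend (h \<circ> e) ` ?P"
      then obtain a b where "a \<in> ?P" "b \<in> ?P" "x = frag_extend (h \<circ> e) a" "y = frag_extend (h \<circ> e) b"
        by blast
      then show "x - y \<in> frag_extend (h \<circ> e) ` ?P"
        by (intro image_eqI[of _ _ "a - b"]) (simp_all add: frag_extend_diff keys_diff_subset)
    qed
    ultimately obtain s where "s \<le> r" "free_of_rank (frag_extend (h \<circ> e) ` ?P) s"
      using free_of_rank_subgroup_nat by blast
    then show ?thesis using free_of_rank_unique[OF im] by blast
  qed
  define T where "T = inv_into (carrier G) h ` frag_of ` {..<r}"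
  have F: "frag_of i \<in> carrier ?F" if "i < r" for i using that by simp
  have hinv: "h (inv_into (carrier G) h (frag_of i)) = frag_of i" if "i < r" for i
    using bij_betw_inv_into_right[OF bij F[OF that]] .
  have inj: "inj_on (\<lambda>i. inv_into (carrier G) h (frag_of i)) {..<r}"
    by (rule inj_onI) (metis frag_of_eq hinv lessThan_iff)
  have T: "T = (\<lambda>i. inv_into (carrier G) h (frag_of i)) ` {..<r}"
    by (simp add: T_def image_image)
  have "int_independent G T"
    unfolding indep
  proof (intro conjI allI impI)
    show "finite T" by (simp add: T_def)
    show "T \<subseteq> carrier G"
      unfolding T using F bij_betwE[OF bij_betw_inv_into[OF bij]] by blast
    fix c assume "(\<Sum>x\<in>T. frag_cmul (c x) (h x)) = 0"
    then have eq: "(\<Sum>i<r. frag_cmul (c (inv_into (carrier G) h (frag_of i))) (frag_of i)) = 0"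
      unfolding T by (simp add: sum.reindex[OF inj] hinv)
    have "c (inv_into (carrier G) h (frag_of i)) = 0" if "i < r" for i
    proof -
      let ?c = "\<lambda>j. c (inv_into (carrier G) h (frag_of j))"
      have "(\<Sum>j<r. ?c j * (if i = j then 1 else 0)) = (\<Sum>j<r. if i = j then ?c j else 0)"
        by (rule sum.cong) auto
      then show ?thesis
        using arg_cong[OF eq, of "\<lambda>x. Poly_Mapping.lookup x i"] that by (simp add: lookup_sum)
    qed
    then show "\<forall>x\<in>T. c x = 0" by (auto simp: T)
  qed
  moreover have "card T = r" by (simp add: T card_image[OF inj])
  ultimately show ?thesis
    unfolding abelian_rank_def by (intro antisym SUP_least SUP_upper2) (auto dest: le)
qed

section \<open>Reduced simplicial homology\<close>

definition simplicial_complex :: "'a set set \<Rightarrow> bool" where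
  "simplicial_complex K \<longleftrightarrow>
     (\<forall>s \<in> K. finite s \<and> s \<noteq> {} \<and> (\<forall>t. t \<subseteq> s \<longrightarrow> t \<noteq> {} \<longrightarrow> t \<in> K))"

lemma simplicial_complex_subset:
  assumes "simplicial_complex K" "s \<in> insert {} K" "t \<subseteq> s"
  shows "t \<in> insert {} K"
proof (cases "t = {}")
  case False
  then have "s \<in> K" using assms by auto
  then show ?thesis using assms False unfolding simplicial_complex_def by blast
qed simp

abbreviation chains :: "int \<Rightarrow> 'a set set \<Rightarrow> ('a set \<Rightarrow>\<^sub>0 int) set" where
  "chains p K \<equiv> {c. Poly_Mapping.keys c \<subseteq> reduced_simplices p K}"

text \<open>The sign is that of the face opposite \<open>x\<close> in \<open>insert x s\<close>, so
  this face has coefficient one in the boundary of the cone: it is the oriented simplex with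
  \<open>x\<close> written first.\<close>

definition cone :: "'a::linorder \<Rightarrow> 'a set \<Rightarrow> ('a set \<Rightarrow>\<^sub>0 int)" where
  "cone x s = (if x \<in> s then 0 else frag_cmul ((-1) ^ card {u \<in> s. u < x}) (frag_of (insert x s)))"

text \<open>Coning to \<open>x\<close> is a chain homotopy between the identity and zero on the
  augmented complex.\<close>

lemma boundary_cone:
  fixes x :: "'a::linorder"
  assumes s: "finite s"
  shows "frag_extend face_boundary (cone x s) + frag_extend (cone x) (face_boundary s) = frag_of s"
proof -
  have C: "frag_extend (cone x) (face_boundary s) =
      (\<Sum>v \<in> s. frag_cmul ((-1) ^ card {u \<in> s. u < v}) (cone x (s - {v})))"
    using s by (simp add: face_boundary_def frag_extend_sum frag_extend_cmul comp_def)
  show ?thesis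
  proof (cases "x \<in> s")
    case True
    have eq: "{u \<in> s - {x}. u < x} = {u \<in> s. u < x}" by auto
    \<comment> \<open>Coning a face that still contains \<open>x\<close> gives zero, so only the
      face opposite \<open>x\<close> survives.\<close>
    have "(\<Sum>v \<in> s. frag_cmul ((-1) ^ card {u \<in> s. u < v}) (cone x (s - {v})))
        = (\<Sum>v \<in> {x}. frag_cmul ((-1) ^ card {u \<in> s. u < v}) (cone x (s - {v})))"
      using s True by (intro sum.mono_neutral_right) (auto simp: cone_def)
    moreover have "cone x (s - {x}) = frag_cmul ((-1) ^ card {u \<in> s. u < x}) (frag_of s)"
      unfolding cone_def eq using True by (simp add: insert_absorb)
    ultimately have "(\<Sum>v \<in> s. frag_cmul ((-1) ^ card {u \<in> s. u < v}) (cone x (s - {v}))) = frag_of s"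
      by (simp flip: power_add)
    then show ?thesis using True by (simp add: C cone_def)
  next
    case False
    let ?e = "(-1::int) ^ card {u \<in> s. u < x}"
    have "frag_extend face_boundary (cone x s) = frag_cmul ?e (face_boundary (insert x s))"
      using False by (simp add: cone_def frag_extend_cmul)
    also have "\<dots> = frag_cmul ?e (frag_cmul ((-1) ^ card {u \<in> insert x s. u < x}) (frag_of (insert x s - {x})))
        + frag_cmul ?e (\<Sum>v \<in> s. frag_cmul ((-1) ^ card {u \<in> insert x s. u < v}) (frag_of (insert x s - {v})))"
      using s False by (simp add: face_boundary_def frag_cmul_distrib2)
    also have "frag_cmul ?e (frag_cmul ((-1) ^ card {u \<in> insert x s. u < x}) (frag_of (insert x s - {x}))) = frag_of s"
    proof -
      have "{u \<in> insert x s. u < x} = {u \<in> s. u < x}" by auto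
      then show ?thesis using False by (simp flip: power_add)
    qed
    also have "frag_cmul ?e (\<Sum>v \<in> s. frag_cmul ((-1) ^ card {u \<in> insert x s. u < v}) (frag_of (insert x s - {v})))
        = - (\<Sum>v \<in> s. frag_cmul ((-1) ^ card {u \<in> s. u < v}) (cone x (s - {v})))"
      unfolding frag_cmul_sum sum_negf[symmetric]
    proof (rule sum.cong[OF refl])
      fix v assume v: "v \<in> s"
      then have ne: "v \<noteq> x" using False by auto
      have ins: "insert x s - {v} = insert x (s - {v})" using ne by auto
      \<comment> \<open>Inserting \<open>x\<close> shifts the position of \<open>v\<close> when
        \<open>x < v\<close>; deleting \<open>v\<close> shifts the position of \<open>x\<close> when
        \<open>v < x\<close>. Exactly one of the two happens, which accounts for the minus
        sign.\<close>
      have "{u \<in> insert x s. u < v} = (if x < v then insert x {u \<in> s. u < v} else {u \<in> s. u < v})" by auto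
      then have 1: "card {u \<in> insert x s. u < v} = card {u \<in> s. u < v} + (if x < v then 1 else 0)"
        using s False by simp
      have "{u \<in> s. u < x} = (if v < x then insert v {u \<in> s - {v}. u < x} else {u \<in> s - {v}. u < x})"
        using v by auto
      then have 2: "card {u \<in> s. u < x} = card {u \<in> s - {v}. u < x} + (if v < x then 1 else 0)"
        using s by simp
      show "frag_cmul ?e (frag_cmul ((-1) ^ card {u \<in> insert x s. u < v}) (frag_of (insert x s - {v})))
          = - frag_cmul ((-1) ^ card {u \<in> s. u < v}) (cone x (s - {v}))"
        using ne False unfolding 1 2 ins cone_def by (cases "x < v") (auto simp: power_add mult.commute)
    qed
    finally show ?thesis by (simp add: C)
  qed
qed

lemma boundary_cone_chain:
  assumes "\<And>s. s \<in> Poly_Mapping.keys c \<Longrightarrow> finite s"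
  shows "frag_extend face_boundary (frag_extend (cone x) c)
    + frag_extend (cone x) (frag_extend face_boundary c) = c"
proof -
  have "Poly_Mapping.keys c \<subseteq> {s. finite s}" using assms by auto
  then show ?thesis
  proof (rule free_Abelian_group_induct)
    fix a b
    assume "frag_extend face_boundary (frag_extend (cone x) a) + frag_extend (cone x) (frag_extend face_boundary a) = a"
      and "frag_extend face_boundary (frag_extend (cone x) b) + frag_extend (cone x) (frag_extend face_boundary b) = b"
    then show "frag_extend face_boundary (frag_extend (cone x) (a - b))
        + frag_extend (cone x) (frag_extend face_boundary (a - b)) = a - b"
      unfolding frag_extend_diff by (metis add_diff_add)
  qed (auto simp: boundary_cone)
qed

lemma keys_face_boundary: "finite s \<Longrightarrow> Poly_Mapping.keys (face_boundary s) \<subseteq> (\<lambda>v. s - {v}) ` s"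
  unfolding face_boundary_def by (rule order_trans[OF keys_sum]) auto

text \<open>The cone identity replaces the usual double sum: \<open>insert x s\<close> is up to sign
  the cone over \<open>s\<close>, and taking the boundary of that cone twice leaves the cone over
  the double boundary of \<open>s\<close>, zero by induction.\<close>

lemma boundary_face_boundary:
  assumes "finite s"
  shows "frag_extend face_boundary (face_boundary s) = 0"
  using assms
proof (induction s rule: finite_induct)
  case empty
  show ?case by (simp add: face_boundary_def)
next
  case (insert x s)
  let ?d = "frag_extend face_boundary" and ?e = "(-1::int) ^ card {u \<in> s. u < x}"
  have "\<And>t. t \<in> Poly_Mapping.keys (face_boundary s) \<Longrightarrow> finite t"
    using keys_face_boundary[OF insert.hyps(1)] insert.hyps(1) by blast
  then have "?d (frag_extend (cone x) (face_boundary s)) = face_boundary s"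
    using boundary_cone_chain[of "face_boundary s" x] by (simp add: insert.IH)
  moreover have "?d (cone x s) = frag_of s - frag_extend (cone x) (face_boundary s)"
    using boundary_cone[OF insert.hyps(1), of x] by (simp add: algebra_simps)
  ultimately have "?d (?d (cone x s)) = 0" by (simp add: frag_extend_diff)
  moreover have "frag_of (insert x s) = frag_cmul ?e (cone x s)"
    using insert.hyps(2) by (simp add: cone_def flip: power_add)
  ultimately show ?case
    by (metis frag_cmul_zero2 frag_extend_cmul frag_extend_of)
qed

lemma boundary_boundary:
  assumes "\<And>s. s \<in> Poly_Mapping.keys c \<Longrightarrow> finite s"
  shows "frag_extend face_boundary (frag_extend face_boundary c) = 0"
proof -
  have "Poly_Mapping.keys c \<subseteq> {s. finite s}" using assms by auto
  then show ?thesis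
    by (rule free_Abelian_group_induct) (auto simp: boundary_face_boundary frag_extend_diff)
qed

section \<open>Cycles, boundaries and criteria for exactness\<close>

lemma reduced_simplices_finite:
  "\<lbrakk>simplicial_complex K; s \<in> reduced_simplices p K\<rbrakk> \<Longrightarrow> finite s"
  by (auto simp: reduced_simplices_def simplicial_complex_def)

lemma face_boundary_in_chains:
  assumes K: "simplicial_complex K" and s: "s \<in> reduced_simplices p K"
  shows "face_boundary s \<in> chains (p - 1) K"
proof -
  have "s - {v} \<in> reduced_simplices (p - 1) K" if "v \<in> s" for v
  proof -
    have "s - {v} \<in> insert {} K"
      by (rule simplicial_complex_subset[OF K, of s]) (use s in \<open>auto simp: reduced_simplices_def\<close>)
    moreover have "card (s - {v}) = card s - 1" "card s > 0"
      using reduced_simplices_finite[OF K s] that by (auto simp: card_gt_0_iff)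
    ultimately show ?thesis using s by (auto simp: reduced_simplices_def)
  qed
  then show ?thesis using keys_face_boundary[OF reduced_simplices_finite[OF K s]] by blast
qed

lemma boundary_in_chains:
  assumes "simplicial_complex K" "c \<in> chains p K"
  shows "frag_extend face_boundary c \<in> chains (p - 1) K"
  by (rule frag_extend_in_additive_subgroup[OF additive_subgroup_keys])
    (use face_boundary_in_chains[OF assms(1)] assms(2) in blast)

lemma reduced_cycles_eq: "reduced_cycles p K = {c \<in> chains p K. frag_extend face_boundary c = 0}"
  by (auto simp: reduced_cycles_def reduced_chain_group_def reduced_boundary_def)

lemma reduced_boundaries_eq: "reduced_boundaries p K = frag_extend face_boundary ` chains (p + 1) K"
  by (auto simp: reduced_boundaries_def reduced_chain_group_def reduced_boundary_def free_Abelian_group_def)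

lemma additive_subgroup_reduced_cycles: "additive_subgroup (reduced_cycles p K)"
  unfolding reduced_cycles_eq
  by (intro additive_subgroupI) (simp_all add: frag_extend_diff keys_diff_subset)

lemma additive_subgroup_reduced_boundaries: "additive_subgroup (reduced_boundaries p K)"
proof (rule additive_subgroupI)
  show "0 \<in> reduced_boundaries p K"
    unfolding reduced_boundaries_eq by (rule image_eqI[of _ _ 0]) auto
  fix x y assume "x \<in> reduced_boundaries p K" "y \<in> reduced_boundaries p K"
  then obtain a b where "a \<in> chains (p + 1) K" "b \<in> chains (p + 1) K"
      "x = frag_extend face_boundary a" "y = frag_extend face_boundary b"
    unfolding reduced_boundaries_eq by blast
  then show "x - y \<in> reduced_boundaries p K"
    unfolding reduced_boundaries_eq
    by (intro image_eqI[of _ _ "a - b"]) (simp_all add: frag_extend_diff keys_diff_subset)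
qed

lemma reduced_boundaries_subset_cycles:
  assumes K: "simplicial_complex K"
  shows "reduced_boundaries p K \<subseteq> reduced_cycles p K"
proof -
  have "frag_extend face_boundary c \<in> reduced_cycles p K" if c: "c \<in> chains (p + 1) K" for c
  proof -
    have "frag_extend face_boundary (frag_extend face_boundary c) = 0"
      by (rule boundary_boundary) (use c reduced_simplices_finite[OF K] in blast)
    then show ?thesis using boundary_in_chains[OF K c] by (simp add: reduced_cycles_eq)
  qed
  then show ?thesis by (auto simp: reduced_boundaries_eq)
qed

text \<open>On a cycle the term with \<open>g\<close> vanishes, so contracting every simplex modulo
  \<open>B\<close> puts all cycles into \<open>B\<close>. Since \<open>g\<close> is a function of
  the facet alone, the difficulty in using this is to choose it consistently on facets shared by
  several simplices.\<close>

lemma contraction_chain: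
  assumes B: "additive_subgroup B"
    and g: "\<And>s. s \<in> S \<Longrightarrow> frag_of s - frag_extend g (face_boundary s) \<in> B"
    and c: "Poly_Mapping.keys c \<subseteq> S"
  shows "c - frag_extend g (frag_extend face_boundary c) \<in> B"
  using c
proof (rule free_Abelian_group_induct)
  fix a b
  assume "a - frag_extend g (frag_extend face_boundary a) \<in> B"
    and "b - frag_extend g (frag_extend face_boundary b) \<in> B"
  from additive_subgroup_diff[OF B this]
  show "a - b - frag_extend g (frag_extend face_boundary (a - b)) \<in> B"
    by (simp add: frag_extend_diff algebra_simps)
qed (use g additive_subgroup_0[OF B] in auto)

lemma cycles_subset_boundariesI:
  assumes "\<And>s. s \<in> reduced_simplices p K \<Longrightarrow>
      frag_of s - frag_extend g (face_boundary s) \<in> reduced_boundaries p K"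
  shows "reduced_cycles p K \<subseteq> reduced_boundaries p K"
proof
  fix c assume c: "c \<in> reduced_cycles p K"
  then have "Poly_Mapping.keys c \<subseteq> reduced_simplices p K" by (simp add: reduced_cycles_eq)
  with assms have "c - frag_extend g (frag_extend face_boundary c) \<in> reduced_boundaries p K"
    by (rule contraction_chain[OF additive_subgroup_reduced_boundaries])
  then show "c \<in> reduced_boundaries p K" using c by (simp add: reduced_cycles_eq)
qed

text \<open>The first isomorphism theorem for \<open>\<Psi>\<close>, followed by coordinates with
  respect to a basis of its image.\<close>

lemma homology_iso_free:
  fixes \<Psi> :: "('a::linorder set \<Rightarrow>\<^sub>0 int) \<Rightarrow> ('c \<Rightarrow>\<^sub>0 int)"
  assumes add: "\<And>x y. \<Psi> (x - y) = \<Psi> x - \<Psi> y"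
    and ker: "{z \<in> reduced_cycles p K. \<Psi> z = 0} = reduced_boundaries p K"
    and im: "free_of_rank (\<Psi> ` reduced_cycles p K) r"
  shows "reduced_simplicial_homology p K \<cong> free_Abelian_group {..<r}"
    and "comm_group (reduced_simplicial_homology p K)"
proof -
  let ?C = "reduced_chain_group p K" and ?Z = "reduced_cycles p K"
    and ?F = "free_Abelian_group {..<r}" and ?P = "{c. Poly_Mapping.keys c \<subseteq> {..<r}}"
  let ?G = "subgroup_generated ?C ?Z"
  interpret C: comm_group ?C unfolding reduced_chain_group_def by (rule abelian_free_Abelian_group)
  have Z: "subgroup ?Z ?C"
    using additive_subgroup_reduced_cycles[of p K]
    unfolding reduced_chain_group_def
    by (intro group.subgroupI)
      (auto simp: reduced_cycles_eq additive_subgroup_0 additive_subgroup_uminus additive_subgroup_add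
         frag_extend_minus frag_extend_add dest!: subsetD[OF keys_add] intro!: exI[of _ 0])
  then have carrier: "carrier ?G = ?Z" by (rule subgroup.carrier_subgroup_generated_subgroup)
  interpret G: comm_group ?G by (rule C.abelian_subgroup_generated) (rule C.comm_group_axioms)
  interpret F: comm_group ?F by (rule abelian_free_Abelian_group)
  have plus: "\<Psi> (x + y) = \<Psi> x + \<Psi> y" for x y
    using add[of x "- y"] add[of 0 y] add[of 0 0] by simp
  obtain b where b: "bij_betw (frag_extend b) ?P (\<Psi> ` ?Z)"
    using im by (auto simp: free_of_rank_def)
  define h where "h = inv_into ?P (frag_extend b) \<circ> \<Psi>"
  have h: "h z \<in> ?P" "frag_extend b (h z) = \<Psi> z" if "z \<in> ?Z" for z
    using bij_betwE[OF bij_betw_inv_into[OF b]] bij_betw_inv_into_right[OF b] that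
    unfolding h_def comp_def by blast+
  have h_unique: "h z = c" if "z \<in> ?Z" "c \<in> ?P" "frag_extend b c = \<Psi> z" for z c
    using that h bij_betw_imp_inj_on[OF b] by (metis inj_onD)
  have hom: "h \<in> hom ?G ?F"
  proof (rule homI)
    show "h x \<in> carrier ?F" if "x \<in> carrier ?G" for x using h that carrier by auto
    fix x y assume "x \<in> carrier ?G" "y \<in> carrier ?G"
    then have xy: "x \<in> ?Z" "y \<in> ?Z" using carrier by auto
    have "h (x + y) = h x + h y"
    proof (rule h_unique)
      show "h x + h y \<in> ?P" using h xy by (auto dest!: subsetD[OF keys_add])
    qed (use xy h in \<open>auto simp: frag_extend_add plus intro!: additive_subgroup_add[OF additive_subgroup_reduced_cycles]\<close>)
    then show "h (x \<otimes>\<^bsub>?G\<^esub> y) = h x \<otimes>\<^bsub>?F\<^esub> h y"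
      by (simp add: reduced_chain_group_def)
  qed
  interpret h: group_hom ?G ?F h by unfold_locales (rule hom)
  have "h ` carrier ?G = carrier ?F"
  proof
    show "carrier ?F \<subseteq> h ` carrier ?G"
    proof
      fix c assume "c \<in> carrier ?F"
      then have c: "c \<in> ?P" by simp
      then obtain z where "z \<in> ?Z" "frag_extend b c = \<Psi> z" using bij_betwE[OF b] by blast
      then show "c \<in> h ` carrier ?G" using h_unique[OF _ c] carrier by blast
    qed
  qed (use h.hom_closed in blast)
  moreover have "kernel ?G ?F h = reduced_boundaries p K"
  proof -
    have "h z = 0 \<longleftrightarrow> \<Psi> z = 0" if "z \<in> ?Z" for z
      using h[OF that] h_unique[OF that, of 0] by auto
    then show ?thesis using ker by (auto simp: kernel_def carrier)
  qed
  ultimately show iso: "reduced_simplicial_homology p K \<cong> ?F"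
    using h.FactGroup_iso unfolding reduced_simplicial_homology_def by simp
  show "comm_group (reduced_simplicial_homology p K)"
    unfolding reduced_simplicial_homology_def \<open>kernel ?G ?F h = reduced_boundaries p K\<close>[symmetric]
    by (rule G.abelian_FactGroup) (rule h.subgroup_kernel)
qed

lemma trivial_homology:
  assumes K: "simplicial_complex K" and sub: "reduced_cycles p K \<subseteq> reduced_boundaries p K"
  shows "trivial_group (reduced_simplicial_homology p K)"
proof -
  \<comment> \<open>Once every cycle bounds, the zero map has the boundaries as its kernel, and its
    image is free of rank 0.\<close>
  let ?\<Psi> = "\<lambda>_. 0 :: nat \<Rightarrow>\<^sub>0 int"
  have "?\<Psi> ` reduced_cycles p K = {0}"
    using additive_subgroup_0[OF additive_subgroup_reduced_cycles] by blast
  then have *: "free_of_rank (?\<Psi> ` reduced_cycles p K) 0" using free_of_rank_zero by metis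
  have ker: "{z \<in> reduced_cycles p K. ?\<Psi> z = 0} = reduced_boundaries p K"
    using sub reduced_boundaries_subset_cycles[OF K] by auto
  have "trivial_group (free_Abelian_group {..<0::nat})"
    unfolding trivial_group_def by (simp, auto simp: free_Abelian_group_def)
  then show ?thesis
    using homology_iso_free[OF _ ker *] isomorphic_group_triviality
    by (metis comm_group.axioms(2) diff_zero group_free_Abelian_group)
qed

lemma finite_reduced_simplices: "finite K \<Longrightarrow> finite (reduced_simplices p K)"
  by (simp add: reduced_simplices_def)

text \<open>In each degree \<open>p\<close>, the number of simplices is the sum of the ranks of the \<open>p\<close>-cycles and of
  the \<open>(p - 1)\<close>-boundaries, so that the alternating sum telescopes.\<close>

lemma euler_char_concentrated_homology:
  fixes K :: "'a::linorder set set"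
    and \<Psi> :: "('a::linorder set \<Rightarrow>\<^sub>0 int) \<Rightarrow> ('c \<Rightarrow>\<^sub>0 int)"
  assumes K: "simplicial_complex K" "finite K"
    and exact: "\<And>p. p \<noteq> int d \<Longrightarrow> reduced_cycles p K \<subseteq> reduced_boundaries p K"
    and add: "\<And>x y. \<Psi> (x - y) = \<Psi> x - \<Psi> y"
    and ker: "{z \<in> reduced_cycles d K. \<Psi> z = 0} = reduced_boundaries d K"
    and im: "free_of_rank (\<Psi> ` reduced_cycles d K) r"
  shows "complex_euler_char K - 1 = (-1) ^ d * int r"
proof -
  \<comment> \<open>\<open>N q\<close> counts the simplices with \<open>q\<close> vertices, so the
    empty simplex of degree -1 has index 0.\<close>
  define N where "N q = card (reduced_simplices (int q - 1) K)" for q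
  have "\<exists>z b. free_of_rank (reduced_cycles p K) z \<and> free_of_rank (reduced_boundaries p K) b" for p
  proof -
    have "free_of_rank (chains p K) (card (reduced_simplices p K))"
      by (rule free_of_rank_keys[OF finite_reduced_simplices[OF K(2)]])
    note sub = free_of_rank_subgroup[OF this additive_subgroup_keys]
    have "reduced_cycles p K \<subseteq> chains p K" by (auto simp: reduced_cycles_eq)
    moreover from this have "reduced_boundaries p K \<subseteq> chains p K"
      using reduced_boundaries_subset_cycles[OF K(1)] by blast
    ultimately show ?thesis
      using sub[OF additive_subgroup_reduced_cycles] sub[OF additive_subgroup_reduced_boundaries] by blast
  qed
  then obtain z b where z: "\<And>p. free_of_rank (reduced_cycles p K) (z p)"
    and b: "\<And>p. free_of_rank (reduced_boundaries p K) (b p)" by metis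
  have Nzb: "card (reduced_simplices p K) = b (p - 1) + z p" for p
  proof -
    have "free_of_rank (frag_extend face_boundary ` chains p K) (b (p - 1))"
      using b[of "p - 1"] by (simp add: reduced_boundaries_eq)
    moreover have "free_of_rank {c \<in> chains p K. frag_extend face_boundary c = 0} (z p)"
      using z[of p] by (simp add: reduced_cycles_eq)
    ultimately have "free_of_rank (chains p K) (b (p - 1) + z p)"
      by (intro free_of_rank_image_kernel[OF additive_subgroup_keys frag_extend_diff])
    then show ?thesis
      using free_of_rank_unique[OF free_of_rank_keys[OF finite_reduced_simplices[OF K(2)]]] by metis
  qed
  have zb: "z p = b p + (if p = int d then r else 0)" for p
  proof (cases "p = int d")
    case True
    have "free_of_rank (reduced_cycles d K) (r + b d)"
      by (rule free_of_rank_image_kernel[OF additive_subgroup_reduced_cycles add im])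
        (use b ker in simp)
    then show ?thesis using free_of_rank_unique[OF z] True by fastforce
  next
    case False
    then have "reduced_cycles p K = reduced_boundaries p K"
      using exact reduced_boundaries_subset_cycles[OF K(1)] by blast
    then show ?thesis using free_of_rank_unique[OF z[of p], of "b p"] b[of p] False by simp
  qed
  have b0: "b (-2) = 0"
  proof -
    have "reduced_boundaries (-2) K = {0}"
    proof -
      have "frag_extend face_boundary c = 0" if "c \<in> chains (-1) K" for c
        by (rule frag_extend_eq_0) (use that K in \<open>auto simp: reduced_simplices_def simplicial_complex_def face_boundary_def\<close>)
      then show ?thesis
        using additive_subgroup_0[OF additive_subgroup_reduced_boundaries[of "-2" K]]
        by (auto simp: reduced_boundaries_eq)
    qed
    then show ?thesis using free_of_rank_unique[OF b[of "-2"]] free_of_rank_zero by metis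
  qed
  \<comment> \<open>The cycles of degree \<open>d\<close> are counted at index \<open>d + 1\<close>,
    but the sign and the rank \<open>r\<close> first show up in the partial sum once
    \<open>d < M\<close>.\<close>
  have partial: "(\<Sum>q\<le>M. (-1) ^ q * int (N q)) =
      (-1) ^ M * int (b (int M - 1)) + (if d < M then (-1) ^ (d + 1) * int r else 0)" for M
  proof (induction M)
    case 0
    show ?case using Nzb[of "-1"] zb[of "-1"] b0 by (simp add: N_def)
  next
    case (Suc M)
    have "int M = int d \<longleftrightarrow> M = d" by simp
    then have "int (N (Suc M)) = int (b (int M - 1)) + int (b (int M)) + (if M = d then int r else 0)"
      using Nzb[of "int M"] zb[of "int M"] by (simp add: N_def)
    moreover have "int (Suc M) - 1 = int M" by simp
    ultimately show ?case
      using Suc.IH by (cases d M rule: linorder_cases) (simp_all add: algebra_simps)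
  qed
  \<comment> \<open>\<open>M\<close> exceeds \<open>d\<close> and the size of every simplex, so
    \<open>r\<close> has been counted and the boundary term left over at the end is zero.\<close>
  define M where "M = Suc (Max (insert d (card ` K)))"
  have M: "card s < M" if "s \<in> K" for s
    using that K(2) by (auto simp: M_def less_Suc_eq_le)
  have dM: "d < M" using K(2) by (auto simp: M_def less_Suc_eq_le)
  have "reduced_simplices (int M) K = {}"
    using M by (fastforce simp: reduced_simplices_def)
  then have "b (int M - 1) = 0" using Nzb[of "int M"] by simp
  with partial[of M] dM have "(\<Sum>q\<le>M. (-1) ^ q * int (N q)) = (-1) ^ (d + 1) * int r" by simp
  moreover have "(\<Sum>q\<le>M. (-1) ^ q * int (N q)) = (\<Sum>s \<in> insert {} K. (-1) ^ card s)"
  proof -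
    have "(\<Sum>q\<le>M. (-1) ^ q * int (N q)) = (\<Sum>q\<le>M. \<Sum>s \<in> {s \<in> insert {} K. card s = q}. (-1) ^ card s)"
      by (rule sum.cong) (auto simp: N_def reduced_simplices_def)
    also have "\<dots> = (\<Sum>s \<in> insert {} K. (-1) ^ card s)"
      using K(2) M by (intro sum.group) (auto simp: less_imp_le)
    finally show ?thesis .
  qed
  moreover have "(\<Sum>s \<in> insert {} K. (-1) ^ card s) = 1 - complex_euler_char K"
  proof -
    have "{} \<notin> K" using K(1) by (auto simp: simplicial_complex_def)
    moreover have "(-1) ^ card s = - ((-1::int) ^ (card s - 1))" if "s \<in> K" for s
    proof -
      have "card s > 0" using K(1) that by (auto simp: simplicial_complex_def card_gt_0_iff)
      then show ?thesis by (cases "card s") auto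
    qed
    ultimately show ?thesis using K(2) by (simp add: complex_euler_char_def sum_negf)
  qed
  ultimately show ?thesis by simp
qed

lemma cone_boundary_mem:
  assumes K: "simplicial_complex K" and s: "s \<in> reduced_simplices p K" and x: "insert x s \<in> K"
  shows "frag_of s - frag_extend (cone x) (face_boundary s) \<in> reduced_boundaries p K"
proof -
  have fin: "finite s" by (rule reduced_simplices_finite[OF K s])
  have "cone x s \<in> chains (p + 1) K"
  proof (cases "x \<in> s")
    case False
    then have "insert x s \<in> reduced_simplices (p + 1) K"
      using s x fin by (auto simp: reduced_simplices_def)
    then show ?thesis using False by (auto simp: cone_def)
  qed (simp add: cone_def)
  moreover have "frag_extend face_boundary (cone x s) = frag_of s - frag_extend (cone x) (face_boundary s)"
    using boundary_cone[OF fin, of x] by (simp add: algebra_simps)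
  ultimately show ?thesis unfolding reduced_boundaries_eq by (metis imageI)
qed

section \<open>Complexes covered by two families of blocks\<close>

text \<open>One apex is chosen for each block and not for each simplex, so all facets of a simplex
  are coned to the same vertex as soon as they determine its block.\<close>

definition apex :: "'a set set \<Rightarrow> 'a set \<Rightarrow> 'a" where
  "apex \<A> t = (SOME x. x \<in> (THE A. A \<in> \<A> \<and> t \<subseteq> A))"

definition block_contraction :: "'a::linorder set set \<Rightarrow> 'a set \<Rightarrow> ('a set \<Rightarrow>\<^sub>0 int)" where
  "block_contraction \<A> t = cone (apex \<A> t) t"

definition in_block :: "'a set set \<Rightarrow> 'a set \<Rightarrow> bool" where
  "in_block \<A> s \<longleftrightarrow> (\<exists>A \<in> \<A>. s \<subseteq> A)"

text \<open>The axiom of a partial linear space: two points lie on at most one line.\<close>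

definition linear_blocks :: "'a set set \<Rightarrow> bool" where
  "linear_blocks \<A> \<longleftrightarrow> (\<forall>A \<in> \<A>. \<forall>B \<in> \<A>. \<forall>x \<in> A \<inter> B. \<forall>y \<in> A \<inter> B. x \<noteq> y \<longrightarrow> A = B)"

lemma apex_eq:
  assumes lin: "linear_blocks \<A>" and A: "A \<in> \<A>" "t \<subseteq> A" and t: "2 \<le> card t"
  shows "apex \<A> t = (SOME x. x \<in> A)"
proof -
  obtain x y where xy: "x \<in> t" "y \<in> t" "x \<noteq> y"
    using t by (auto simp: numeral_2_eq_2 card_le_Suc_iff)
  have "(THE A. A \<in> \<A> \<and> t \<subseteq> A) = A"
    using A xy lin unfolding linear_blocks_def by (intro the_equality) blast+
  then show ?thesis by (simp add: apex_def)
qed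

text \<open>The bound on \<open>p\<close> leaves at least two vertices in each facet of
  \<open>s\<close>. A facet therefore lies in no other block of \<open>\<A>\<close> and is coned to
  the apex of the block of \<open>s\<close>.\<close>

lemma block_contraction_mem:
  assumes K: "simplicial_complex K" and lin: "linear_blocks \<A>"
    and blocks: "\<And>A s. \<lbrakk>A \<in> \<A>; finite s; s \<noteq> {}; s \<subseteq> A\<rbrakk> \<Longrightarrow> s \<in> K"
    and s: "s \<in> reduced_simplices p K" "in_block \<A> s" and p: "2 \<le> p"
  shows "frag_of s - frag_extend (block_contraction \<A>) (face_boundary s) \<in> reduced_boundaries p K"
proof -
  obtain A where A: "A \<in> \<A>" "s \<subseteq> A" using s by (auto simp: in_block_def)
  have fin: "finite s" by (rule reduced_simplices_finite[OF K s(1)])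
  have card: "3 \<le> card s" using s(1) p by (auto simp: reduced_simplices_def)
  define x where "x = (SOME x. x \<in> A)"
  have "A \<noteq> {}" using A card by auto
  then have "x \<in> A" unfolding x_def by (simp add: some_in_eq)
  then have "insert x s \<in> K" using A fin by (intro blocks[OF A(1)]) auto
  then have "frag_of s - frag_extend (cone x) (face_boundary s) \<in> reduced_boundaries p K"
    by (rule cone_boundary_mem[OF K s(1)])
  moreover have "frag_extend (block_contraction \<A>) (face_boundary s) = frag_extend (cone x) (face_boundary s)"
  proof (rule frag_extend_eq)
    fix t assume "t \<in> Poly_Mapping.keys (face_boundary s)"
    then obtain v where "v \<in> s" "t = s - {v}" using keys_face_boundary[OF fin] by blast
    then have "2 \<le> card t" "t \<subseteq> A" using fin card A by auto
    then show "block_contraction \<A> t = cone x t"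
      using apex_eq[OF lin A(1)] by (simp add: block_contraction_def x_def)
  qed
  ultimately show ?thesis by simp
qed

lemma image_free_of_rank:
  fixes \<Psi> :: "('a \<Rightarrow>\<^sub>0 int) \<Rightarrow> ('b \<Rightarrow>\<^sub>0 int)"
  assumes "additive_subgroup Z" "\<And>x y. \<Psi> (x - y) = \<Psi> x - \<Psi> y"
    and "\<Psi> ` Z \<subseteq> {c. Poly_Mapping.keys c \<subseteq> S}" "finite S"
  obtains r where "free_of_rank (\<Psi> ` Z) r"
proof -
  have "additive_subgroup (\<Psi> ` Z)"
  proof (rule additive_subgroupI)
    have "\<Psi> 0 = 0" using assms(2)[of 0 0] by simp
    then show "0 \<in> \<Psi> ` Z" using additive_subgroup_0[OF assms(1)] by (metis imageI)
    fix x y assume "x \<in> \<Psi> ` Z" "y \<in> \<Psi> ` Z"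
    then obtain a b where "a \<in> Z" "b \<in> Z" "x = \<Psi> a" "y = \<Psi> b" by blast
    then show "x - y \<in> \<Psi> ` Z"
      by (intro image_eqI[of _ _ "a - b"]) (simp_all add: assms(2) additive_subgroup_diff[OF assms(1)])
  qed
  then show ?thesis
    using free_of_rank_subgroup[OF free_of_rank_keys[OF assms(4)] additive_subgroup_keys _ assms(3)] that
    by blast
qed

text \<open>The kind of a simplex is determined only from three vertices on. Edges may lie in blocks
  of both kinds.\<close>

locale two_block_complex =
  fixes K :: "'a::linorder set set" and \<A> \<B> :: "'a set set"
  assumes complex: "simplicial_complex K"
    and block_simplex: "\<And>A s. \<lbrakk>A \<in> \<A> \<union> \<B>; finite s; s \<noteq> {}; s \<subseteq> A\<rbrakk> \<Longrightarrow> s \<in> K"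
    and linear: "linear_blocks \<A>" "linear_blocks \<B>"
    and dichotomy: "\<And>s. \<lbrakk>s \<in> K; 3 \<le> card s\<rbrakk> \<Longrightarrow> in_block \<A> s \<noteq> in_block \<B> s"
begin

text \<open>With \<open>3 \<le> p\<close> the facets still have three vertices, so
  \<open>dichotomy\<close> applies to them as well, and each facet lies in the block that contains
  \<open>s\<close>.\<close>

lemma face_in_block:
  assumes s: "s \<in> reduced_simplices p K" "3 \<le> p" and t: "t \<in> Poly_Mapping.keys (face_boundary s)"
  shows "in_block \<A> t \<longleftrightarrow> in_block \<A> s" "in_block \<B> t \<longleftrightarrow> in_block \<B> s"
proof -
  have fin: "finite s" by (rule reduced_simplices_finite[OF complex s(1)])
  obtain v where v: "v \<in> s" "t = s - {v}" using keys_face_boundary[OF fin] t by blast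
  have "4 \<le> card s" "s \<in> K" using s by (auto simp: reduced_simplices_def)
  moreover from this have "3 \<le> card t" using v fin by auto
  moreover have "t \<noteq> {}" using \<open>3 \<le> card t\<close> by auto
  then have "t \<in> K"
    using v \<open>s \<in> K\<close> simplicial_complex_subset[OF complex, of s t] by blast
  moreover have "in_block \<A> s \<Longrightarrow> in_block \<A> t" "in_block \<B> s \<Longrightarrow> in_block \<B> t"
    using v by (auto simp: in_block_def)
  ultimately show "in_block \<A> t \<longleftrightarrow> in_block \<A> s" "in_block \<B> t \<longleftrightarrow> in_block \<B> s"
    using dichotomy[of s] dichotomy[of t] by auto
qed

lemma contraction_mem:
  assumes "s \<in> reduced_simplices p K" "2 \<le> p"
  shows "in_block \<A> s \<Longrightarrow> frag_of s - frag_extend (block_contraction \<A>) (face_boundary s) \<in> reduced_boundaries p K"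
    and "in_block \<B> s \<Longrightarrow> frag_of s - frag_extend (block_contraction \<B>) (face_boundary s) \<in> reduced_boundaries p K"
proof -
  have "\<And>A s. \<lbrakk>A \<in> \<A>; finite s; s \<noteq> {}; s \<subseteq> A\<rbrakk> \<Longrightarrow> s \<in> K"
    "\<And>A s. \<lbrakk>A \<in> \<B>; finite s; s \<noteq> {}; s \<subseteq> A\<rbrakk> \<Longrightarrow> s \<in> K"
    using block_simplex by blast+
  note * = block_contraction_mem[OF complex linear(1) this(1) assms(1) _ assms(2)]
    block_contraction_mem[OF complex linear(2) this(2) assms(1) _ assms(2)]
  show "in_block \<A> s \<Longrightarrow> frag_of s - frag_extend (block_contraction \<A>) (face_boundary s) \<in> reduced_boundaries p K"
    and "in_block \<B> s \<Longrightarrow> frag_of s - frag_extend (block_contraction \<B>) (face_boundary s) \<in> reduced_boundaries p K"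
    using * by simp_all
qed

lemma dichotomy_simplices:
  assumes "s \<in> reduced_simplices p K" "2 \<le> p"
  shows "in_block \<A> s \<noteq> in_block \<B> s"
  using assms by (intro dichotomy) (auto simp: reduced_simplices_def)

lemma exact_high_degree:
  assumes p: "3 \<le> p"
  shows "reduced_cycles p K \<subseteq> reduced_boundaries p K"
proof (rule cycles_subset_boundariesI)
  fix s assume s: "s \<in> reduced_simplices p K"
  \<comment> \<open>All facets have the kind of \<open>s\<close>, so the contraction can be chosen
    by looking at the facet only.\<close>
  let ?g = "\<lambda>t. if in_block \<A> t then block_contraction \<A> t else block_contraction \<B> t"
  show "frag_of s - frag_extend ?g (face_boundary s) \<in> reduced_boundaries p K"
  proof (cases "in_block \<A> s")
    case True
    then have "frag_extend ?g (face_boundary s) = frag_extend (block_contraction \<A>) (face_boundary s)"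
      using face_in_block[OF s p] by (intro frag_extend_eq) auto
    then show ?thesis using contraction_mem(1)[OF s _ True] p by simp
  next
    case False
    then have "frag_extend ?g (face_boundary s) = frag_extend (block_contraction \<B>) (face_boundary s)"
      using face_in_block[OF s p] by (intro frag_extend_eq) auto
    then show ?thesis using contraction_mem(2)[OF s] dichotomy_simplices[OF s] False p by simp
  qed
qed

section \<open>Degree 2: splitting cycles by the kind of block\<close>

definition \<A>_part :: "('a set \<Rightarrow>\<^sub>0 int) \<Rightarrow> ('a set \<Rightarrow>\<^sub>0 int)" where
  "\<A>_part = frag_extend (\<lambda>s. if in_block \<A> s then frag_of s else 0)"

lemma
  shows \<A>_part_of_\<A>: "(\<And>s. s \<in> Poly_Mapping.keys c \<Longrightarrow> in_block \<A> s) \<Longrightarrow> \<A>_part c = c"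
    and \<A>_part_of_other: "(\<And>s. s \<in> Poly_Mapping.keys c \<Longrightarrow> \<not> in_block \<A> s) \<Longrightarrow> \<A>_part c = 0"
proof -
  show "\<A>_part c = c" if "\<And>s. s \<in> Poly_Mapping.keys c \<Longrightarrow> in_block \<A> s"
  proof -
    have "\<A>_part c = frag_extend frag_of c"
      unfolding \<A>_part_def by (rule frag_extend_eq) (simp add: that)
    then show ?thesis by (simp flip: frag_expansion)
  qed
  show "\<A>_part c = 0" if "\<And>s. s \<in> Poly_Mapping.keys c \<Longrightarrow> \<not> in_block \<A> s"
    unfolding \<A>_part_def by (rule frag_extend_eq_0) (simp add: that)
qed

lemma \<A>_part_decomposition:
  assumes "c \<in> chains p K"
  obtains d e where "c = d + e" "\<A>_part c = d"
    "Poly_Mapping.keys d \<subseteq> {s \<in> reduced_simplices p K. in_block \<A> s}"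
    "Poly_Mapping.keys e \<subseteq> {s \<in> reduced_simplices p K. \<not> in_block \<A> s}"
proof -
  have "Poly_Mapping.keys c \<subseteq> {s \<in> reduced_simplices p K. in_block \<A> s} \<union> {s \<in> reduced_simplices p K. \<not> in_block \<A> s}"
    using assms by blast
  then obtain d e where de: "Poly_Mapping.keys d \<subseteq> {s \<in> reduced_simplices p K. in_block \<A> s}"
    "Poly_Mapping.keys e \<subseteq> {s \<in> reduced_simplices p K. \<not> in_block \<A> s}" "d + e = c"
    by (rule frag_split)
  have "\<A>_part d = d" "\<A>_part e = 0"
    using de by (auto intro!: \<A>_part_of_\<A> \<A>_part_of_other)
  moreover have "\<A>_part (d + e) = \<A>_part d + \<A>_part e"
    by (simp add: \<A>_part_def frag_extend_add)
  ultimately have "\<A>_part c = d" using de(3) by simp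
  then show ?thesis using that[OF de(3)[symmetric] _ de(1,2)] by simp
qed

text \<open>A 2-cycle is the sum of its parts in the two families of blocks, whose boundaries are
  opposite chains of edges. This common chain of edges determines the homology class.\<close>

definition seam :: "('a set \<Rightarrow>\<^sub>0 int) \<Rightarrow> ('a set \<Rightarrow>\<^sub>0 int)" where
  "seam c = frag_extend face_boundary (\<A>_part c)"

lemma seam_diff: "seam (x - y) = seam x - seam y"
  by (simp add: seam_def \<A>_part_def frag_extend_diff)

text \<open>If the seam of a cycle vanishes, its two parts are cycles separately, and each is
  contracted within its own family of blocks. Conversely, the facets of a 3-simplex are all of one
  kind, so the part of its boundary in \<open>\<A>\<close> is everything or nothing, and in both
  cases a cycle.\<close>

lemma seam_kernel: "{z \<in> reduced_cycles 2 K. seam z = 0} = reduced_boundaries 2 K"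
proof
  show "{z \<in> reduced_cycles 2 K. seam z = 0} \<subseteq> reduced_boundaries 2 K"
  proof
    fix z assume "z \<in> {z \<in> reduced_cycles 2 K. seam z = 0}"
    then have z: "z \<in> chains 2 K" "frag_extend face_boundary z = 0" "seam z = 0"
      by (auto simp: reduced_cycles_eq)
    obtain d e where de: "z = d + e" "\<A>_part z = d"
      and d: "Poly_Mapping.keys d \<subseteq> {s \<in> reduced_simplices 2 K. in_block \<A> s}"
      and e: "Poly_Mapping.keys e \<subseteq> {s \<in> reduced_simplices 2 K. \<not> in_block \<A> s}"
      by (rule \<A>_part_decomposition[OF z(1)])
    have 0: "frag_extend face_boundary d = 0" "frag_extend face_boundary e = 0"
      using z de by (simp_all add: seam_def frag_extend_add)
    have "d - frag_extend (block_contraction \<A>) (frag_extend face_boundary d) \<in> reduced_boundaries 2 K"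
      by (rule contraction_chain[OF additive_subgroup_reduced_boundaries _ d])
        (use contraction_mem(1) in auto)
    moreover have "e - frag_extend (block_contraction \<B>) (frag_extend face_boundary e) \<in> reduced_boundaries 2 K"
      by (rule contraction_chain[OF additive_subgroup_reduced_boundaries _ e])
        (use contraction_mem(2) dichotomy_simplices in auto)
    ultimately show "z \<in> reduced_boundaries 2 K"
      using additive_subgroup_add[OF additive_subgroup_reduced_boundaries] by (simp add: 0 de)
  qed
  have "seam (frag_extend face_boundary w) = 0" if "w \<in> chains 3 K" for w
  proof -
    have "Poly_Mapping.keys w \<subseteq> reduced_simplices 3 K" using that by simp
    then show ?thesis
    proof (rule free_Abelian_group_induct)
      fix s assume s: "s \<in> reduced_simplices 3 K"
      have "seam (face_boundary s) = 0"
      proof (cases "in_block \<A> s")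
        case True
        then have "\<A>_part (face_boundary s) = face_boundary s"
          using face_in_block(1)[OF s] by (intro \<A>_part_of_\<A>) auto
        then show ?thesis
          using boundary_face_boundary[OF reduced_simplices_finite[OF complex s]] by (simp add: seam_def)
      next
        case False
        then have "\<A>_part (face_boundary s) = 0"
          using face_in_block(1)[OF s] by (intro \<A>_part_of_other) auto
        then show ?thesis by (simp add: seam_def)
      qed
      then show "seam (frag_extend face_boundary (frag_of s)) = 0" by simp
    qed (simp_all add: frag_extend_diff seam_diff, simp add: seam_def \<A>_part_def)
  qed
  then show "reduced_boundaries 2 K \<subseteq> {z \<in> reduced_cycles 2 K. seam z = 0}"
    using reduced_boundaries_subset_cycles[OF complex, of 2] by (auto simp: reduced_boundaries_eq)
qed

lemma seam_in_chains: "seam ` reduced_cycles 2 K \<subseteq> chains 1 K"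
proof
  fix x assume "x \<in> seam ` reduced_cycles 2 K"
  then obtain z where z: "z \<in> chains 2 K" "x = seam z" by (auto simp: reduced_cycles_eq)
  obtain d e where "z = d + e" "\<A>_part z = d"
    "Poly_Mapping.keys d \<subseteq> {s \<in> reduced_simplices 2 K. in_block \<A> s}"
    "Poly_Mapping.keys e \<subseteq> {s \<in> reduced_simplices 2 K. \<not> in_block \<A> s}"
    by (rule \<A>_part_decomposition[OF z(1)])
  then have "\<A>_part z \<in> chains 2 K" by auto
  from boundary_in_chains[OF complex this] show "x \<in> chains 1 K" by (simp add: z seam_def)
qed

theorem homology_concentrated:
  assumes fin: "finite K"
    and exact: "\<And>p. p \<le> 1 \<Longrightarrow> reduced_cycles p K \<subseteq> reduced_boundaries p K"
  shows "(\<forall>i::int. i \<noteq> 2 \<longrightarrow> trivial_group (reduced_simplicial_homology i K))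
    \<and> (\<exists>r::nat. int r = complex_euler_char K - 1
      \<and> reduced_simplicial_homology 2 K \<cong> free_Abelian_group {..<r}
      \<and> abelian_rank (reduced_simplicial_homology 2 K) = enat r)"
proof
  have ex: "reduced_cycles p K \<subseteq> reduced_boundaries p K" if "p \<noteq> 2" for p
    using that exact[of p] exact_high_degree[of p] by linarith
  then show "\<forall>i. i \<noteq> 2 \<longrightarrow> trivial_group (reduced_simplicial_homology i K)"
    using trivial_homology[OF complex] by blast
  obtain r where r: "free_of_rank (seam ` reduced_cycles 2 K) r"
    using image_free_of_rank[OF additive_subgroup_reduced_cycles seam_diff seam_in_chains
      finite_reduced_simplices[OF fin]] .
  have "complex_euler_char K - 1 = (-1) ^ 2 * int r"
    by (rule euler_char_concentrated_homology[OF complex fin _ seam_diff]) (use ex seam_kernel r in auto)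
  moreover note homology_iso_free[OF seam_diff seam_kernel r]
  ultimately show "\<exists>r::nat. int r = complex_euler_char K - 1
      \<and> reduced_simplicial_homology 2 K \<cong> free_Abelian_group {..<r}
      \<and> abelian_rank (reduced_simplicial_homology 2 K) = enat r"
    using abelian_rank_iso_free_Abelian_group by (intro exI[of _ r]) auto
qed

end

section \<open>Levels of a lattice of finite sets\<close>

text \<open>Equality counts as near. Unions of different pairs may coincide in the induction, and
  the cocycle condition has to cover them too.\<close>

definition near :: "'b set \<Rightarrow> 'b set \<Rightarrow> bool" where
  "near X Y \<longleftrightarrow> card X = card Y \<and> card X \<le> Suc (card (X \<inter> Y))"

lemma near_refl: "near X X"
  by (simp add: near_def)

lemma near_sym: "near X Y \<longleftrightarrow> near Y X"
  by (auto simp: near_def Int_commute)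

lemma near_if_common_subset:
  assumes "finite X" "N \<subseteq> X" "N \<subseteq> Y" "card X = Suc (card N)" "card Y = Suc (card N)"
  shows "near X Y"
proof -
  have "card N \<le> card (X \<inter> Y)" using assms by (intro card_mono) auto
  then show ?thesis using assms by (simp add: near_def)
qed

lemma card_Int_near:
  assumes "finite X" "finite Y" "near X Y" "X \<noteq> Y"
  shows "card X = Suc (card (X \<inter> Y))"
proof -
  have "card (X \<inter> Y) \<noteq> card X"
    using assms by (metis card_subset_eq inf_le1 inf_le2 near_def)
  moreover have "card (X \<inter> Y) \<le> card X" using assms by (intro card_mono) auto
  ultimately show ?thesis using assms by (auto simp: near_def)
qed

lemma card_Un_near:
  assumes "finite X" "finite Y" "near X Y" "X \<noteq> Y"
  shows "card (X \<union> Y) = Suc (card X)"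
  using card_Un_Int[OF assms(1,2)] card_Int_near[OF assms] assms(3) by (simp add: near_def)

lemma common_superset_cases:
  assumes Z: "finite Z" "X \<subseteq> Z" "Y \<subseteq> Z" "card Z = Suc (card X)" "card Y = card X" and "X \<noteq> Y"
  shows "X \<union> Y = Z" "near X Y"
proof -
  have fin: "finite X" "finite Y" using Z finite_subset by blast+
  have "\<not> Y \<subseteq> X" using card_subset_eq[OF fin(1)] Z(5) assms(6) by metis
  then have "card X < card (X \<union> Y)" using fin by (intro psubset_card_mono) auto
  moreover have "card (X \<union> Y) \<le> card Z" using Z by (intro card_mono) auto
  ultimately show XY: "X \<union> Y = Z" using Z by (intro card_subset_eq) auto
  show "near X Y" using card_Un_Int[OF fin] Z XY by (simp add: near_def)
qed

lemma near_if_common_superset: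
  assumes "finite Z" "X \<subseteq> Z" "Y \<subseteq> Z" "card Z = Suc (card X)" "card Y = card X"
  shows "near X Y"
  using common_superset_cases[OF assms] near_refl by metis

text \<open>The intended instance is Young's lattice. \<open>removable\<close> provides every
  nonempty member with a member one point smaller, so that questions about a level can be passed to
  the level below.\<close>

locale finite_set_lattice =
  fixes L :: "'b set set"
  assumes finite_member: "X \<in> L \<Longrightarrow> finite X"
    and Un_member: "\<lbrakk>X \<in> L; Y \<in> L\<rbrakk> \<Longrightarrow> X \<union> Y \<in> L"
    and Int_member: "\<lbrakk>X \<in> L; Y \<in> L\<rbrakk> \<Longrightarrow> X \<inter> Y \<in> L"
    and removable: "\<lbrakk>X \<in> L; X \<noteq> {}\<rbrakk> \<Longrightarrow> \<exists>x \<in> X. X - {x} \<in> L"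
begin

definition level :: "nat \<Rightarrow> 'b set set" where
  "level n = {X \<in> L. card X = n}"

text \<open>The base point of the clique of members covering \<open>N\<close>; local potentials are
  normalised there.\<close>

definition above :: "'b set \<Rightarrow> 'b set" where
  "above N = (SOME X. X \<in> level (Suc (card N)) \<and> N \<subseteq> X)"

definition below :: "'b set \<Rightarrow> 'b set" where
  "below X = (SOME N. N \<in> level (card X - 1) \<and> N \<subseteq> X)"

lemma above:
  assumes "N \<in> level n" "X \<in> level (Suc n)" "N \<subseteq> X"
  shows "above N \<in> level (Suc n)" "N \<subseteq> above N"
proof -
  have "card N = n" using assms by (simp add: level_def)
  then show "above N \<in> level (Suc n)" "N \<subseteq> above N"
    using someI[of "\<lambda>X. X \<in> level (Suc (card N)) \<and> N \<subseteq> X" X] assms by (auto simp: above_def)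
qed

lemma below:
  assumes X: "X \<in> level (Suc n)"
  shows "below X \<in> level n" "below X \<subseteq> X"
proof -
  have "X \<in> L" "X \<noteq> {}" using X by (auto simp: level_def)
  then obtain x where "x \<in> X" "X - {x} \<in> L" using removable by blast
  then have "X - {x} \<in> level (card X - 1) \<and> X - {x} \<subseteq> X"
    using X finite_member by (auto simp: level_def)
  then have "below X \<in> level (card X - 1) \<and> below X \<subseteq> X" unfolding below_def by (rule someI)
  then show "below X \<in> level n" "below X \<subseteq> X" using X by (auto simp: level_def)
qed

lemma near_above:
  assumes "N \<in> level n" "X \<in> level (Suc n)" "Y \<in> level (Suc n)" "N \<subseteq> X" "N \<subseteq> Y"
  shows "near X Y"
  using assms finite_member by (intro near_if_common_subset[of X N Y]) (auto simp: level_def)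

lemma near_below:
  assumes "N \<in> level n" "M \<in> level n" "X \<in> level (Suc n)" "N \<subseteq> X" "M \<subseteq> X"
  shows "near N M" "N \<noteq> M \<Longrightarrow> N \<union> M = X"
  using assms finite_member near_if_common_superset[of X N M] common_superset_cases(1)[of X N M]
  by (auto simp: level_def)

lemma Int_level:
  assumes "X \<in> level (Suc n)" "Y \<in> level (Suc n)" "near X Y" "X \<noteq> Y"
  shows "X \<inter> Y \<in> level n"
  using assms card_Int_near[OF finite_member finite_member, of X Y] Int_member by (auto simp: level_def)

lemma Un_level:
  assumes "X \<in> level n" "Y \<in> level n" "near X Y" "X \<noteq> Y"
  shows "X \<union> Y \<in> level (Suc n)"
  using assms card_Un_near[OF finite_member finite_member, of X Y] Un_member by (auto simp: level_def)

text \<open>Connectedness, phrased for functions modulo \<open>B\<close> instead of paths, as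
  exactness in degree 0 requires. The induction passes to \<open>h (above N)\<close> as a function
  of \<open>N\<close>: members covering a common \<open>N\<close> are near, and distinct near
  \<open>N\<close>, \<open>M\<close> have the common cover \<open>N \<union> M\<close>.\<close>

lemma level_connected:
  fixes h :: "'b set \<Rightarrow> 'g::ab_group_add"
  assumes B: "additive_subgroup B"
    and h: "\<And>X Y. \<lbrakk>X \<in> level n; Y \<in> level n; near X Y\<rbrakk> \<Longrightarrow> h X - h Y \<in> B"
    and XY: "X \<in> level n" "Y \<in> level n"
  shows "h X - h Y \<in> B"
  using h XY
proof (induction n arbitrary: h X Y)
  case 0
  have "X = Y" using 0(2,3) finite_member by (auto simp: level_def)
  then show ?case using additive_subgroup_0[OF B] by simp
next
  case (Suc n)
  have above_const: "h X - h (above N) \<in> B" if "N \<in> level n" "X \<in> level (Suc n)" "N \<subseteq> X" for N X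
    using Suc.prems(1)[OF that(2) above(1)[OF that]] near_above[OF that(1,2) above(1)[OF that] that(3) above(2)[OF that]]
    by blast
  have "h (above N) - h (above M) \<in> B" if NM: "N \<in> level n" "M \<in> level n" "near N M" for N M
  proof (cases "N = M")
    case False
    have U: "N \<union> M \<in> level (Suc n)" by (rule Un_level[OF NM False])
    then show ?thesis
      using additive_subgroup_diff[OF B above_const[OF NM(2) U] above_const[OF NM(1) U]] by simp
  qed (use additive_subgroup_0[OF B] in simp)
  then have mid: "h (above (below X)) - h (above (below Y)) \<in> B"
    by (rule Suc.IH) (use below Suc.prems in auto)
  have ends: "h X - h (above (below X)) \<in> B" "h Y - h (above (below Y)) \<in> B"
    using above_const below Suc.prems by auto
  note additive_subgroup_add[OF B additive_subgroup_diff[OF B ends] mid]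
  then show ?case by (simp add: algebra_simps)
qed

text \<open>The cocycle restricts to a coboundary on the clique of all sets covering a given \<open>N\<close>; the
  discrepancies between these local potentials form a cocycle on the level below.\<close>

lemma level_cocycle:
  fixes f :: "'b set \<Rightarrow> 'b set \<Rightarrow> 'g::ab_group_add"
  assumes B: "additive_subgroup B"
    and f0: "\<And>X. X \<in> level n \<Longrightarrow> f X X \<in> B"
    and f3: "\<And>X Y Z. \<lbrakk>X \<in> level n; Y \<in> level n; Z \<in> level n; near X Y; near Y Z; near X Z\<rbrakk>
      \<Longrightarrow> f X Y + f Y Z + f Z X \<in> B"
  shows "\<exists>g. \<forall>X \<in> level n. \<forall>Y \<in> level n. near X Y \<longrightarrow> f X Y - (g Y - g X) \<in> B"
  using f0 f3
proof (induction n arbitrary: f)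
  case 0
  have "X = Y" if "X \<in> level 0" "Y \<in> level 0" for X Y
    using that finite_member by (auto simp: level_def)
  then have "\<forall>X \<in> level 0. \<forall>Y \<in> level 0. near X Y \<longrightarrow> f X Y - (0 - 0) \<in> B"
    using 0(1) by fastforce
  then show ?case by (intro exI[of _ "\<lambda>_. 0"])
next
  case (Suc n)
  note addB = additive_subgroup_add[OF B] and diffB = additive_subgroup_diff[OF B]
  have anti: "f X Y + f Y X \<in> B" if "X \<in> level (Suc n)" "Y \<in> level (Suc n)" "near X Y" for X Y
    using diffB[OF Suc.prems(2)[of X Y X] Suc.prems(1)[of X]] that near_refl near_sym by auto
  \<comment> \<open>The potential is obtained by integrating \<open>f\<close> from the base point of
    the clique over \<open>N\<close>.\<close>
  define h where "h N X = f (above N) X" for N X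
  have local: "f X Y - (h N Y - h N X) \<in> B"
    if N: "N \<in> level n" and X: "X \<in> level (Suc n)" "N \<subseteq> X" and Y: "Y \<in> level (Suc n)" "N \<subseteq> Y" for N X Y
  proof -
    note A = above[OF N X]
    have "h N X + f X Y + f Y (above N) \<in> B"
      unfolding h_def
      using Suc.prems(2)[OF A(1) X(1) Y(1)] near_above[OF N _ _ _ _] A X Y by blast
    moreover have "h N Y + f Y (above N) \<in> B"
      unfolding h_def using anti[OF A(1) Y(1)] near_above[OF N A(1) Y(1) A(2) Y(2)] by blast
    ultimately have "(h N X + f X Y + f Y (above N)) - (h N Y + f Y (above N)) \<in> B" by (rule diffB)
    then show ?thesis by (simp add: algebra_simps)
  qed
  define f' where "f' N M = h N (N \<union> M) - h M (N \<union> M)" for N M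
  have "\<exists>g. \<forall>N \<in> level n. \<forall>M \<in> level n. near N M \<longrightarrow> f' N M - (g M - g N) \<in> B"
  proof (rule Suc.IH)
    show "f' N N \<in> B" for N using additive_subgroup_0[OF B] by (simp add: f'_def)
    fix N0 N1 N2 assume N: "N0 \<in> level n" "N1 \<in> level n" "N2 \<in> level n"
      and near: "near N0 N1" "near N1 N2" "near N0 N2"
    show "f' N0 N1 + f' N1 N2 + f' N2 N0 \<in> B"
    proof (cases "N0 = N1 \<or> N1 = N2 \<or> N0 = N2")
      case True
      then have "f' N0 N1 + f' N1 N2 + f' N2 N0 = 0" by (auto simp: f'_def Un_commute)
      then show ?thesis using additive_subgroup_0[OF B] by simp
    next
      case False
      \<comment> \<open>Any two of these unions share one of \<open>N0\<close>, \<open>N1\<close>,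
        \<open>N2\<close>, hence are near; all three may coincide. Replacing \<open>f\<close> on
        each side by the local potential of the shared set turns the relation for \<open>f\<close>
        into the one for \<open>f'\<close>.\<close>
      let ?X = "N0 \<union> N1" and ?Y = "N1 \<union> N2" and ?Z = "N2 \<union> N0"
      have XYZ: "?X \<in> level (Suc n)" "?Y \<in> level (Suc n)" "?Z \<in> level (Suc n)"
        using Un_level N near False near_sym by metis+
      have sum: "f ?X ?Y + f ?Y ?Z + f ?Z ?X \<in> B"
        using XYZ near_above[OF N(2) XYZ(1,2)] near_above[OF N(3) XYZ(2,3)] near_above[OF N(1) XYZ(1,3)]
        by (intro Suc.prems(2)) auto
      have "f ?X ?Y - (h N1 ?Y - h N1 ?X) \<in> B" "f ?Y ?Z - (h N2 ?Z - h N2 ?Y) \<in> B"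
          "f ?Z ?X - (h N0 ?X - h N0 ?Z) \<in> B"
        using N XYZ by (auto intro!: local)
      note diffB[OF diffB[OF diffB[OF sum this(1)] this(2)] this(3)]
      then show ?thesis by (simp add: f'_def algebra_simps)
    qed
  qed
  then obtain g' where g': "\<And>N M. \<lbrakk>N \<in> level n; M \<in> level n; near N M\<rbrakk> \<Longrightarrow> f' N M - (g' M - g' N) \<in> B"
    by blast
  \<comment> \<open>Correcting the local potentials by \<open>g'\<close> makes them agree modulo
    \<open>B\<close>, as the next claim shows, so \<open>below X\<close> may be any member that
    \<open>X\<close> covers.\<close>
  define g where "g X = h (below X) X + g' (below X)" for X
  have g: "h N X + g' N - g X \<in> B" if "N \<in> level n" "X \<in> level (Suc n)" "N \<subseteq> X" for N X
  proof (cases "N = below X")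
    case True
    then show ?thesis using additive_subgroup_0[OF B] by (simp add: g_def)
  next
    case False
    note nb = near_below[OF that(1) below(1)[OF that(2)] that(2,3) below(2)[OF that(2)]]
    have "f' N (below X) - (g' (below X) - g' N) \<in> B"
      using g' nb(1) that(1) below(1)[OF that(2)] by blast
    then show ?thesis using nb(2)[OF False] by (simp add: f'_def g_def algebra_simps)
  qed
  have "f X Y - (g Y - g X) \<in> B" if XY: "X \<in> level (Suc n)" "Y \<in> level (Suc n)" "near X Y" for X Y
  proof (cases "X = Y")
    case True
    then show ?thesis using Suc.prems(1) XY by simp
  next
    case False
    \<comment> \<open>Both sets cover \<open>X \<inter> Y\<close>, so a single local potential sees
      this edge.\<close>
    let ?N = "X \<inter> Y"
    have N: "?N \<in> level n" by (rule Int_level[OF XY False])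
    have "?N \<subseteq> X" "?N \<subseteq> Y" by auto
    note diffB[OF addB[OF local[OF N XY(1) this(1) XY(2) this(2)] g[OF N XY(2) this(2)]] g[OF N XY(1) this(1)]]
    then show ?thesis by (simp add: algebra_simps)
  qed
  then show ?case by blast
qed

end

section \<open>Cliques in a level\<close>

context finite_set_lattice
begin

text \<open>Each single \<open>Z\<close> contains \<open>X \<inter> Y\<close> or lies in
  \<open>X \<union> Y\<close>. If \<open>Z\<close> fails the first and \<open>W\<close> the second,
  then \<open>W\<close> meets \<open>X \<union> Y\<close> only in \<open>X \<inter> Y\<close>, so
  \<open>Z \<inter> W\<close> is a proper part of \<open>X \<inter> Y\<close> and too small for near
  sets.\<close>

lemma levels_dichotomy:
  assumes S: "S \<subseteq> level (Suc n)" and near: "\<And>X Y. \<lbrakk>X \<in> S; Y \<in> S\<rbrakk> \<Longrightarrow> near X Y"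
    and XY: "X \<in> S" "Y \<in> S" "X \<noteq> Y"
  shows "(\<forall>Z \<in> S. X \<inter> Y \<subseteq> Z) \<or> (\<forall>Z \<in> S. Z \<subseteq> X \<union> Y)"
proof (rule ccontr)
  assume "\<not> ?thesis"
  then obtain Z W where Z: "Z \<in> S" "\<not> X \<inter> Y \<subseteq> Z" and W: "W \<in> S" "\<not> W \<subseteq> X \<union> Y" by blast
  have fin: "finite U" "card U = Suc n" if "U \<in> S" for U
    using that S finite_member by (auto simp: level_def)
  have Int: "card (U \<inter> V) = n" if "U \<in> S" "V \<in> S" "U \<noteq> V" for U V
    using card_Int_near[OF fin(1) fin(1) near] that fin(2) by force
  have other: "Z \<subseteq> X \<union> Y \<or> X \<inter> Y \<subseteq> Z" if ZS: "Z \<in> S" for Z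
  proof (rule ccontr)
    assume "\<not> ?thesis"
    then obtain p q where p: "p \<in> X" "p \<in> Y" "p \<notin> Z" and q: "q \<in> Z" "q \<notin> X" "q \<notin> Y" by blast
    \<comment> \<open>A member containing \<open>p\<close> but not \<open>q\<close> arises from
      \<open>Z\<close> by exchanging \<open>q\<close> for \<open>p\<close>. This describes both
      \<open>X\<close> and \<open>Y\<close>.\<close>
    have det: "U = insert p (Z - {q})" if U: "U \<in> S" "p \<in> U" "q \<notin> U" for U
    proof -
      have ne: "U \<noteq> Z" using p U by auto
      have "U \<inter> Z \<subseteq> U - {p}" "U \<inter> Z \<subseteq> Z - {q}" using p U by auto
      moreover have "card (U \<inter> Z) = card (U - {p})" "card (U \<inter> Z) = card (Z - {q})"
        using Int[OF U(1) ZS ne] fin U ZS q by auto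
      ultimately have "U \<inter> Z = U - {p}" "U \<inter> Z = Z - {q}"
        using card_subset_eq fin[OF U(1)] fin[OF ZS] by (meson finite_Diff)+
      then show ?thesis using U by blast
    qed
    have "X = Y" using det[OF XY(1) p(1) q(2)] det[OF XY(2) p(2) q(3)] by simp
    then show False using XY by simp
  qed
  have XYW: "X \<inter> Y \<subseteq> W" and ZXY: "Z \<subseteq> X \<union> Y" using other Z W by auto
  have "X \<inter> Y = W \<inter> (X \<union> Y)"
  proof (rule card_subset_eq)
    show "finite (W \<inter> (X \<union> Y))" using fin W by auto
    show "X \<inter> Y \<subseteq> W \<inter> (X \<union> Y)" using XYW by auto
    have "card (W \<inter> (X \<union> Y)) < card W" using W fin by (intro psubset_card_mono) auto
    moreover have "card (X \<inter> Y) \<le> card (W \<inter> (X \<union> Y))" using XYW fin W by (intro card_mono) auto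
    ultimately show "card (X \<inter> Y) = card (W \<inter> (X \<union> Y))" using Int[OF XY] fin(2)[OF W(1)] by simp
  qed
  then have "Z \<inter> W \<subset> X \<inter> Y" using ZXY Z by blast
  then have "card (Z \<inter> W) < n" using Int[OF XY] fin XY by (metis finite_Int psubset_card_mono)
  moreover have "Z \<noteq> W" using XYW Z by auto
  ultimately show False using Int[OF Z(1) W(1)] by simp
qed

end

section \<open>The clique complex of a level\<close>

text \<open>A middle member is \<open>N\<close> with one of the two points of \<open>M - N\<close>.
  This is what prevents a clique of three from lying in blocks of both kinds.\<close>

lemma card_interval_le_2:
  assumes "finite M" "N \<subseteq> M" "card M = Suc (Suc (card N))"
    and S: "\<And>X. X \<in> S \<Longrightarrow> N \<subseteq> X \<and> X \<subseteq> M \<and> card X = Suc (card N)"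
  shows "card S \<le> 2"
proof -
  have finN: "finite N" using assms finite_subset by blast
  have "(\<lambda>X. X - N) ` S \<subseteq> {T. T \<subseteq> M - N \<and> card T = 1}"
  proof
    fix T assume "T \<in> (\<lambda>X. X - N) ` S"
    then obtain X where X: "X \<in> S" "T = X - N" by blast
    then have "card T = 1" using S[OF X(1)] finN by (simp add: card_Diff_subset)
    then show "T \<in> {T. T \<subseteq> M - N \<and> card T = 1}" using X S[OF X(1)] by auto
  qed
  moreover have "finite {T. T \<subseteq> M - N \<and> card T = 1}" using assms(1) by simp
  moreover have "card {T. T \<subseteq> M - N \<and> card T = 1} = 2"
    using assms finN by (simp add: n_subsets card_Diff_subset)
  ultimately have "card ((\<lambda>X. X - N) ` S) \<le> 2" using card_mono by fastforce
  moreover have "inj_on (\<lambda>X. X - N) S"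
    by (rule inj_onI) (use S in blast)
  ultimately show ?thesis by (simp add: card_image)
qed

lemma cone_boundary_chain_mem:
  assumes K: "simplicial_complex K" and c: "c \<in> chains p K"
    and x: "\<And>s. s \<in> Poly_Mapping.keys c \<Longrightarrow> insert x s \<in> K"
  shows "c - frag_extend (cone x) (frag_extend face_boundary c) \<in> reduced_boundaries p K"
  by (rule contraction_chain[OF additive_subgroup_reduced_boundaries, where S = "{s \<in> reduced_simplices p K. insert x s \<in> K}"])
    (use c x cone_boundary_mem[OF K] in auto)

text \<open>Coning a point makes the edge antisymmetric in its ends and zero when they coincide, and
  its boundary can be read off from the cone identity.\<close>

definition oriented_edge :: "'a::linorder \<Rightarrow> 'a \<Rightarrow> ('a set \<Rightarrow>\<^sub>0 int)" where
  "oriented_edge u v = cone u {v}"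

lemma oriented_edge_less: "u < v \<Longrightarrow> oriented_edge u v = frag_of {u, v}"
  and oriented_edge_greater: "v < u \<Longrightarrow> oriented_edge u v = - frag_of {u, v}"
  and oriented_edge_refl: "oriented_edge u u = 0"
proof -
  have "{x \<in> {v}. x < u} = (if v < u then {v} else {})" by auto
  then show "u < v \<Longrightarrow> oriented_edge u v = frag_of {u, v}"
    "v < u \<Longrightarrow> oriented_edge u v = - frag_of {u, v}" "oriented_edge u u = 0"
    by (auto simp: oriented_edge_def cone_def)
qed

lemma oriented_edge_swap: "oriented_edge u v = - oriented_edge v u"
  by (cases u v rule: linorder_cases)
    (simp_all add: oriented_edge_less oriented_edge_greater oriented_edge_refl insert_commute)

lemma keys_oriented_edge: "Poly_Mapping.keys (oriented_edge u v) \<subseteq> {{u, v}}"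
  by (cases u v rule: linorder_cases)
    (simp_all add: oriented_edge_less oriented_edge_greater oriented_edge_refl)

lemma face_boundary_singleton: "face_boundary {v} = frag_of {}"
proof -
  have eq: "{u. u = v \<and> u < v} = {}" by auto
  show ?thesis by (simp add: face_boundary_def eq)
qed

lemma cone_empty: "cone u {} = frag_of {u}"
  by (simp add: cone_def)

lemma boundary_oriented_edge:
  "frag_extend face_boundary (oriented_edge u v) = frag_of {v} - frag_of {u}"
  using boundary_cone[of "{v}" u]
  by (simp add: oriented_edge_def face_boundary_singleton cone_empty algebra_simps)

text \<open>Contract the edge from \<open>v\<close> to \<open>w\<close> towards \<open>u\<close>:
  the cones over its two ends are the other two edges.\<close>

lemma oriented_edge_cocycle:
  assumes K: "simplicial_complex K" and uvw: "{u, v, w} \<in> K" "u \<noteq> v" "v \<noteq> w" "u \<noteq> w"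
  shows "oriented_edge u v + oriented_edge v w + oriented_edge w u \<in> reduced_boundaries 1 K"
proof -
  have "{v, w} \<in> insert {} K" by (rule simplicial_complex_subset[OF K, of "{u, v, w}"]) (use uvw in auto)
  then have "{v, w} \<in> reduced_simplices 1 K" using uvw by (auto simp: reduced_simplices_def)
  then have "oriented_edge v w - frag_extend (cone u) (frag_extend face_boundary (oriented_edge v w))
      \<in> reduced_boundaries 1 K"
    using keys_oriented_edge[of v w] uvw by (intro cone_boundary_chain_mem[OF K]) auto
  then show ?thesis
    using oriented_edge_swap[of w u]
    by (simp add: boundary_oriented_edge frag_extend_diff algebra_simps flip: oriented_edge_def)
qed

text \<open>The vertices carry the linear order that orients simplices, and \<open>d\<close>
  translates them into members of the lattice. The level is a successor, so that there is a level
  below it for \<open>up_blocks\<close>.\<close>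

locale level_clique_complex = finite_set_lattice L for L :: "'b set set" +
  fixes V :: "'a::linorder set" and d :: "'a \<Rightarrow> 'b set" and n :: nat and adj :: "'a \<Rightarrow> 'a \<Rightarrow> bool"
  assumes V: "finite V" "V \<noteq> {}"
    and d: "bij_betw d V (level (Suc n))"
    and adj: "\<And>u v. \<lbrakk>u \<in> V; v \<in> V\<rbrakk> \<Longrightarrow> adj u v \<longleftrightarrow> u \<noteq> v \<and> near (d u) (d v)"
begin

abbreviation "K \<equiv> clique_complex V adj"

lemma in_K_iff:
  "s \<in> K \<longleftrightarrow> finite s \<and> s \<noteq> {} \<and> s \<subseteq> V \<and> (\<forall>u \<in> s. \<forall>v \<in> s. near (d u) (d v))"
proof (cases "s \<subseteq> V")
  case True
  have "(\<forall>u \<in> s. \<forall>v \<in> s. u \<noteq> v \<longrightarrow> adj u v) \<longleftrightarrow> (\<forall>u \<in> s. \<forall>v \<in> s. near (d u) (d v))"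
  proof (intro ball_cong refl)
    fix u v assume "u \<in> s" "v \<in> s"
    then show "(u \<noteq> v \<longrightarrow> adj u v) \<longleftrightarrow> near (d u) (d v)"
      using True adj[of u v] near_refl by (cases "u = v") auto
  qed
  then show ?thesis by (simp add: clique_complex_def)
qed (simp add: clique_complex_def)

lemma complex_K: "simplicial_complex K"
  unfolding simplicial_complex_def
proof (intro ballI conjI allI impI)
  fix s t assume "s \<in> K" "t \<subseteq> s" "t \<noteq> {}"
  then show "t \<in> K" unfolding in_K_iff using finite_subset[of t s] by (simp add: subset_iff)
qed (simp_all add: in_K_iff)

lemma finite_K: "finite K"
  by (rule finite_subset[of _ "Pow V"]) (use V in \<open>auto simp: in_K_iff\<close>)

lemma d_level: "v \<in> V \<Longrightarrow> d v \<in> level (Suc n)"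
  using d bij_betwE by blast

lemma d_card: "v \<in> V \<Longrightarrow> card (d v) = Suc n"
  using d_level finite_member by (auto simp: level_def)

lemma d_eq_iff: "\<lbrakk>u \<in> V; v \<in> V\<rbrakk> \<Longrightarrow> d u = d v \<longleftrightarrow> u = v"
  using d by (auto simp: bij_betw_def inj_on_eq_iff)

definition up_blocks :: "'a set set" where
  "up_blocks = (\<lambda>N. {v \<in> V. N \<subseteq> d v}) ` level n"

definition down_blocks :: "'a set set" where
  "down_blocks = (\<lambda>M. {v \<in> V. d v \<subseteq> M}) ` level (Suc (Suc n))"

text \<open>Two distinct vertices \<open>x\<close>, \<open>y\<close> of a block determine its
  \<open>N\<close> as \<open>d x \<inter> d y\<close>; dually, the union determines a block of the
  other family.\<close>

lemma linear_up_blocks: "linear_blocks up_blocks"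
proof -
  have "N = d x \<inter> d y" if "N \<in> level n" "x \<in> V" "y \<in> V" "x \<noteq> y" "N \<subseteq> d x" "N \<subseteq> d y" for N x y
  proof -
    have "d x \<noteq> d y" using that d_eq_iff by auto
    moreover have "near (d x) (d y)" using near_above d_level that by blast
    ultimately have "d x \<inter> d y \<in> level n" using Int_level d_level that by blast
    then show ?thesis using that finite_member by (intro card_subset_eq) (auto simp: level_def)
  qed
  note N = this
  show ?thesis
    unfolding linear_blocks_def
  proof (intro ballI impI)
    fix A B x y assume AB: "A \<in> up_blocks" "B \<in> up_blocks" and xy: "x \<in> A \<inter> B" "y \<in> A \<inter> B" "x \<noteq> y"
    obtain N M where NM: "N \<in> level n" "A = {v \<in> V. N \<subseteq> d v}" "M \<in> level n" "B = {v \<in> V. M \<subseteq> d v}"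
      using AB by (auto simp: up_blocks_def)
    then have "N = M" using N[of N x y] N[of M x y] xy by simp
    then show "A = B" using NM by simp
  qed
qed

lemma linear_down_blocks: "linear_blocks down_blocks"
proof -
  have "d x \<union> d y = M" if "M \<in> level (Suc (Suc n))" "x \<in> V" "y \<in> V" "x \<noteq> y" "d x \<subseteq> M" "d y \<subseteq> M" for M x y
    using near_below(2)[OF d_level d_level, of x y M] that d_eq_iff by auto
  note M = this
  show ?thesis
    unfolding linear_blocks_def
  proof (intro ballI impI)
    fix A B x y assume AB: "A \<in> down_blocks" "B \<in> down_blocks" and xy: "x \<in> A \<inter> B" "y \<in> A \<inter> B" "x \<noteq> y"
    obtain N M where NM: "N \<in> level (Suc (Suc n))" "A = {v \<in> V. d v \<subseteq> N}"
        "M \<in> level (Suc (Suc n))" "B = {v \<in> V. d v \<subseteq> M}"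
      using AB by (auto simp: down_blocks_def)
    then have "N = M" using M[of N x y] M[of M x y] xy by simp
    then show "A = B" using NM by simp
  qed
qed

text \<open>Two vertices leave only two candidates, the blocks of \<open>d x \<inter> d y\<close>
  and of \<open>d x \<union> d y\<close>. One of them works by \<open>levels_dichotomy\<close>; both
  at once would squeeze three sets into an interval of length two.\<close>

lemma clique_in_one_block:
  assumes s: "s \<in> K" "3 \<le> card s"
  shows "in_block up_blocks s \<noteq> in_block down_blocks s"
proof -
  have sV: "s \<subseteq> V" and near: "\<And>u v. \<lbrakk>u \<in> s; v \<in> s\<rbrakk> \<Longrightarrow> near (d u) (d v)"
    using s by (auto simp: in_K_iff)
  obtain x y where xy: "x \<in> s" "y \<in> s" "x \<noteq> y"
    using s(2) by (auto simp: numeral_3_eq_3 card_le_Suc_iff)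
  have xyV: "x \<in> V" "y \<in> V" using xy sV by auto
  have dxy: "d x \<noteq> d y" using d_eq_iff xy xyV by auto
  have dich: "(\<forall>Z \<in> d ` s. d x \<inter> d y \<subseteq> Z) \<or> (\<forall>Z \<in> d ` s. Z \<subseteq> d x \<union> d y)"
    by (rule levels_dichotomy[of _ n]) (use sV d_level near xy dxy in auto)
  have Int: "d x \<inter> d y \<in> level n"
    using Int_level[OF d_level[OF xyV(1)] d_level[OF xyV(2)] near dxy] xy by blast
  have Un: "d x \<union> d y \<in> level (Suc (Suc n))"
    using Un_level[OF d_level[OF xyV(1)] d_level[OF xyV(2)] near dxy] xy by blast
  from dich have "in_block up_blocks s \<or> in_block down_blocks s"
  proof
    assume "\<forall>Z \<in> d ` s. d x \<inter> d y \<subseteq> Z"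
    then have "s \<subseteq> {v \<in> V. d x \<inter> d y \<subseteq> d v}" using sV by blast
    then show ?thesis using Int unfolding in_block_def up_blocks_def by blast
  next
    assume "\<forall>Z \<in> d ` s. Z \<subseteq> d x \<union> d y"
    then have "s \<subseteq> {v \<in> V. d v \<subseteq> d x \<union> d y}" using sV by blast
    then show ?thesis using Un unfolding in_block_def down_blocks_def by blast
  qed
  moreover have False if "in_block up_blocks s" "in_block down_blocks s"
  proof -
    obtain N M where N: "N \<in> level n" "\<And>v. v \<in> s \<Longrightarrow> N \<subseteq> d v"
      and M: "M \<in> level (Suc (Suc n))" "\<And>v. v \<in> s \<Longrightarrow> d v \<subseteq> M"
      using \<open>in_block up_blocks s\<close> \<open>in_block down_blocks s\<close>
      unfolding in_block_def up_blocks_def down_blocks_def by blast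
    have "card (d ` s) \<le> 2"
    proof (rule card_interval_le_2[of M N])
      show "N \<subseteq> M" using N(2)[OF xy(1)] M(2)[OF xy(1)] by blast
    qed (use N M sV d_card finite_member in \<open>auto simp: level_def\<close>)
    moreover have "card (d ` s) = card s"
      using sV d by (intro card_image) (auto simp: bij_betw_def intro: inj_on_subset)
    ultimately show False using s(2) by simp
  qed
  ultimately show ?thesis by blast
qed

sublocale two_block_complex K up_blocks down_blocks
proof
  show "s \<in> K" if A: "A \<in> up_blocks \<union> down_blocks" and s: "finite s" "s \<noteq> {}" "s \<subseteq> A" for A s
  proof -
    consider N where "N \<in> level n" "A = {v \<in> V. N \<subseteq> d v}"
      | M where "M \<in> level (Suc (Suc n))" "A = {v \<in> V. d v \<subseteq> M}"
      using A by (auto simp: up_blocks_def down_blocks_def)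
    then show ?thesis
    proof cases
      case 1
      then have "near (d u) (d v)" if "u \<in> s" "v \<in> s" for u v
        using that s(3) near_above d_level by blast
      then show ?thesis using 1 s by (auto simp: in_K_iff)
    next
      case 2
      then have "near (d u) (d v)" if "u \<in> s" "v \<in> s" for u v
        using that s(3) near_below(1) d_level by blast
      then show ?thesis using 2 s by (auto simp: in_K_iff)
    qed
  qed
qed (fact complex_K linear_up_blocks linear_down_blocks clique_in_one_block)+

section \<open>Exactness in degrees at most 1\<close>

definition vertex :: "'b set \<Rightarrow> 'a" where
  "vertex = inv_into V d"

lemma vertex: "X \<in> level (Suc n) \<Longrightarrow> vertex X \<in> V" "X \<in> level (Suc n) \<Longrightarrow> d (vertex X) = X"
  using bij_betwE[OF bij_betw_inv_into[OF d]] bij_betw_inv_into_right[OF d] by (auto simp: vertex_def)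

lemma vertex_d: "v \<in> V \<Longrightarrow> vertex (d v) = v"
  using bij_betw_inv_into_left[OF d] by (simp add: vertex_def)

lemma exact_low: "p \<le> -1 \<Longrightarrow> reduced_cycles p K \<subseteq> reduced_boundaries p K"
proof (rule cycles_subset_boundariesI)
  fix s :: "'a set" assume p: "p \<le> -1" and s: "s \<in> reduced_simplices p K"
  have "int (card s) = p + 1" using s by (simp add: reduced_simplices_def)
  then have "card s = 0" using p by linarith
  then have "s = {}" using reduced_simplices_finite[OF complex_K s] by simp
  \<comment> \<open>Only the empty simplex is left, and it is the boundary of any vertex.\<close>
  obtain v where "v \<in> V" using V by auto
  then have "insert v s \<in> K" using \<open>s = {}\<close> near_refl by (auto simp: in_K_iff)
  from cone_boundary_mem[OF complex_K s this]
  show "frag_of s - frag_extend (\<lambda>_. 0) (face_boundary s) \<in> reduced_boundaries p K"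
    using \<open>s = {}\<close> by (simp add: face_boundary_def)
qed

lemma exact_0: "reduced_cycles 0 K \<subseteq> reduced_boundaries 0 K"
proof (rule cycles_subset_boundariesI)
  define v0 where "v0 = (SOME v. v \<in> V)"
  have v0: "v0 \<in> V" using V by (simp add: v0_def some_in_eq)
  fix s assume s: "s \<in> reduced_simplices 0 K"
  then obtain v where sv: "s = {v}" by (auto simp: reduced_simplices_def card_1_singleton_iff)
  then have v: "v \<in> V" using s by (auto simp: reduced_simplices_def in_K_iff)
  \<comment> \<open>Adjacent vertices are homologous, so by connectedness every vertex is homologous
    to the base vertex.\<close>
  have "frag_of {vertex (d v)} - frag_of {vertex (d v0)} \<in> reduced_boundaries 0 K"
  proof (rule level_connected[OF additive_subgroup_reduced_boundaries])
    fix X Y assume XY: "X \<in> level (Suc n)" "Y \<in> level (Suc n)" "near X Y"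
    let ?u = "vertex Y" and ?v = "vertex X"
    have "{?v} \<in> K" "insert ?u {?v} \<in> K"
      using XY XY(3)[THEN near_sym[THEN iffD1]] vertex near_refl by (auto simp: in_K_iff)
    then have "frag_of {?v} - frag_extend (cone ?u) (face_boundary {?v}) \<in> reduced_boundaries 0 K"
      by (intro cone_boundary_mem complex_K) (auto simp: reduced_simplices_def)
    then show "frag_of {vertex X} - frag_of {vertex Y} \<in> reduced_boundaries 0 K"
      by (simp add: face_boundary_singleton cone_empty)
  qed (use v v0 d_level in auto)
  then show "frag_of s - frag_extend (\<lambda>_. frag_of {SOME v. v \<in> V}) (face_boundary s) \<in> reduced_boundaries 0 K"
    using v v0 by (fold v0_def) (simp add: sv face_boundary_singleton vertex_d)
qed

lemma exact_1: "reduced_cycles 1 K \<subseteq> reduced_boundaries 1 K"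
proof -
  let ?B = "reduced_boundaries 1 K" and ?f = "\<lambda>X Y. oriented_edge (vertex X) (vertex Y)"
  note B0 = additive_subgroup_0[OF additive_subgroup_reduced_boundaries[of 1 K]]
  have "\<exists>g. \<forall>X \<in> level (Suc n). \<forall>Y \<in> level (Suc n). near X Y \<longrightarrow> ?f X Y - (g Y - g X) \<in> ?B"
  proof (rule level_cocycle[OF additive_subgroup_reduced_boundaries])
    show "?f X X \<in> ?B" for X using B0 by (simp add: oriented_edge_refl)
    fix X Y Z
    assume XYZ: "X \<in> level (Suc n)" "Y \<in> level (Suc n)" "Z \<in> level (Suc n)"
      and near: "near X Y" "near Y Z" "near X Z"
    let ?u = "vertex X" and ?v = "vertex Y" and ?w = "vertex Z"
    show "?f X Y + ?f Y Z + ?f Z X \<in> ?B"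
    proof (cases "?u = ?v \<or> ?v = ?w \<or> ?u = ?w")
      case True
      then have "?f X Y + ?f Y Z + ?f Z X = 0"
        using oriented_edge_swap[of ?u ?w] oriented_edge_swap[of ?v ?u] oriented_edge_swap[of ?w ?v]
        by (auto simp: oriented_edge_refl)
      then show ?thesis using B0 by simp
    next
      case False
      have "{?u, ?v, ?w} \<in> K"
        using XYZ near near[THEN near_sym[THEN iffD1]] vertex near_refl by (auto simp: in_K_iff)
      then show ?thesis using False by (intro oriented_edge_cocycle complex_K) auto
    qed
  qed
  then obtain g where g: "\<And>X Y. \<lbrakk>X \<in> level (Suc n); Y \<in> level (Suc n); near X Y\<rbrakk>
      \<Longrightarrow> ?f X Y - (g Y - g X) \<in> ?B" by blast
  show ?thesis
  proof (rule cycles_subset_boundariesI)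
    fix s assume s: "s \<in> reduced_simplices 1 K"
    then have sK: "s \<in> K" "card s = 2" by (auto simp: reduced_simplices_def)
    obtain u v where uv: "s = {u, v}" "u < v"
      using sK(2) by (metis card_2_iff insert_commute linorder_neqE)
    have V: "u \<in> V" "v \<in> V" "near (d u) (d v)" using sK uv by (auto simp: in_K_iff)
    have "face_boundary s = frag_of {v} - frag_of {u}"
      using boundary_oriented_edge[of u v] uv by (simp add: oriented_edge_less)
    moreover have "oriented_edge u v - (g (d v) - g (d u)) \<in> ?B"
      using g[OF d_level d_level] V by (simp add: vertex_d)
    \<comment> \<open>The facets are singletons, and \<open>the_elem\<close> returns the vertex at
      which the potential is evaluated.\<close>
    ultimately show "frag_of s - frag_extend (\<lambda>t. g (d (the_elem t))) (face_boundary s) \<in> ?B"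
      using uv by (simp add: frag_extend_diff oriented_edge_less)
  qed
qed

theorem level_homology:
  "(\<forall>i::int. i \<noteq> 2 \<longrightarrow> trivial_group (reduced_simplicial_homology i K))
    \<and> (\<exists>r::nat. int r = complex_euler_char K - 1
      \<and> reduced_simplicial_homology 2 K \<cong> free_Abelian_group {..<r}
      \<and> abelian_rank (reduced_simplicial_homology 2 K) = enat r)"
proof (rule homology_concentrated[OF finite_K])
  fix p :: int assume "p \<le> 1"
  then consider "p \<le> -1" | "p = 0" | "p = 1" by linarith
  then show "reduced_cycles p K \<subseteq> reduced_boundaries p K"
    using exact_low exact_0 exact_1 by cases auto
qed

end

section \<open>Diagrams of partitions\<close>

text \<open>The cell \<open>(c, k)\<close> lies in column \<open>c\<close> and row \<open>k\<close>. Describing the columns by the number of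
  rows longer than \<open>c\<close> makes the diagram invariant under reordering the rows.\<close>

definition diagram :: "nat list \<Rightarrow> (nat \<times> nat) set" where
  "diagram xs = {(c, k). k < length (filter (\<lambda>r. c < r) xs)}"

lemma diagram_normalize_rows: "diagram (normalize_rows xs) = diagram xs"
proof -
  have "filter (\<lambda>r. c < r) (filter (\<lambda>r. 0 < r) xs) = filter (\<lambda>r. c < r) xs" for c :: nat
    by (auto simp: filter_filter intro!: filter_cong)
  then show ?thesis
    by (simp add: diagram_def normalize_rows_def filter_sort flip: rev_filter)
qed

lemma diagram_append_0: "diagram (xs @ [0]) = diagram xs"
  by (simp add: diagram_def)

lemma diagram_mono:
  assumes "list_all2 (\<le>) xs ys"
  shows "diagram xs \<subseteq> diagram ys"
proof -
  have "length (filter (\<lambda>r. c < r) xs) \<le> length (filter (\<lambda>r. c < r) ys)" for c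
    using assms by (induction rule: list_all2_induct) auto
  then show ?thesis by (auto simp: diagram_def intro: less_le_trans)
qed

text \<open>In decreasing order the rows longer than \<open>c\<close> form an initial segment, so
  their number decides whether row \<open>k\<close> is among them.\<close>

lemma mem_diagram_iff:
  assumes "sorted_wrt (\<ge>) xs"
  shows "(c, k) \<in> diagram xs \<longleftrightarrow> k < length xs \<and> c < xs ! k"
  using assms
proof (induction xs arbitrary: k)
  case (Cons x xs)
  show ?case
  proof (cases "c < x")
    case True
    then show ?thesis
      using Cons.IH[of "k - 1"] Cons.prems by (cases k) (auto simp: diagram_def)
  next
    case False
    then have le: "\<forall>r \<in> set (x # xs). \<not> c < r" using Cons.prems by auto
    then have "filter (\<lambda>r. c < r) (x # xs) = []" by (simp only: filter_empty_conv)
    moreover have "\<not> c < (x # xs) ! k" if "k < length (x # xs)"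
      using le nth_mem[OF that] by blast
    ultimately show ?thesis by (auto simp: diagram_def)
  qed
qed (simp add: diagram_def)

lemma normalize_rows_partition: "normalize_rows xs \<in> integer_partitions (sum_list xs)"
proof -
  have "sum_list (filter (\<lambda>k. 0 < k) xs) = sum_list xs" by (induction xs) auto
  moreover have "sum_list (insort x ys) = x + sum_list ys" for x :: nat and ys
    by (induction ys) auto
  then have "sum_list (sort ys) = sum_list ys" for ys :: "nat list"
    by (induction ys) auto
  ultimately have "sum_list (normalize_rows xs) = sum_list xs"
    by (simp add: normalize_rows_def)
  then show ?thesis
    by (simp add: integer_partitions_def sorted_wrt_rev normalize_rows_def)
qed

text \<open>Normalising preserves both the diagram and the sum, so the cells can be counted along
  sorted rows. Unsorted lists are included because they arise halfway through a cell move.\<close>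

lemma card_diagram: "finite (diagram xs)" "card (diagram xs) = sum_list xs"
proof -
  let ?ys = "normalize_rows xs"
  have ys: "sorted_wrt (\<ge>) ?ys" "sum_list ?ys = sum_list xs"
    using normalize_rows_partition[of xs] by (auto simp: integer_partitions_def)
  have eq: "diagram xs = prod.swap ` (SIGMA k:{..<length ?ys}. {..<?ys ! k})"
    using mem_diagram_iff[OF ys(1)] by (force simp: diagram_normalize_rows)
  show "finite (diagram xs)" unfolding eq by simp
  have "card (diagram xs) = card (SIGMA k:{..<length ?ys}. {..<?ys ! k})"
    unfolding eq by (rule card_image) (simp add: inj_on_def)
  also have "\<dots> = sum_list xs"
    using ys(2) by (simp add: sum_list_sum_nth atLeast0LessThan)
  finally show "card (diagram xs) = sum_list xs" .
qed

lemma inj_diagram: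
  assumes xs: "xs \<in> integer_partitions m" and ys: "ys \<in> integer_partitions n"
    and eq: "diagram xs = diagram ys"
  shows "xs = ys"
proof -
  have iff: "k < length xs \<and> c < xs ! k \<longleftrightarrow> k < length ys \<and> c < ys ! k" for c k
    using mem_diagram_iff[of xs c k] mem_diagram_iff[of ys c k] xs ys eq
    by (auto simp: integer_partitions_def)
  \<comment> \<open>All rows are positive, so column 0 recovers the number of rows.\<close>
  have "0 < xs ! k" if "k < length xs" for k
    using xs that by (auto simp: integer_partitions_def)
  moreover have "0 < ys ! k" if "k < length ys" for k
    using ys that by (auto simp: integer_partitions_def)
  ultimately have lt: "k < length xs \<longleftrightarrow> k < length ys" for k
    using iff[of k 0] by blast
  then have len: "length xs = length ys" by (meson linorder_neqE_nat less_irrefl)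
  show ?thesis
  proof (rule nth_equalityI[OF len])
    fix k assume "k < length xs"
    then have "c < xs ! k \<longleftrightarrow> c < ys ! k" for c using iff[of k c] len by simp
    then show "xs ! k = ys ! k" by (meson linorder_neqE_nat less_irrefl)
  qed
qed

text \<open>The finite order ideals of the quadrant, ordered by inclusion: Young's lattice.\<close>

definition diagrams :: "(nat \<times> nat) set set" where
  "diagrams = {D. finite D \<and> (\<forall>c k c' k'. (c, k) \<in> D \<longrightarrow> c' \<le> c \<longrightarrow> k' \<le> k \<longrightarrow> (c', k') \<in> D)}"

lemma diagrams_down: "\<lbrakk>D \<in> diagrams; (c, k) \<in> D; c' \<le> c; k' \<le> k\<rbrakk> \<Longrightarrow> (c', k') \<in> D"
  by (auto simp: diagrams_def)

lemma diagram_in_diagrams: "diagram xs \<in> diagrams"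
proof -
  have "length (filter (\<lambda>r. c < r) xs) \<le> length (filter (\<lambda>r. c' < r) xs)" if "c' \<le> c" for c c'
    using that by (induction xs) auto
  then show ?thesis
    using card_diagram(1)[of xs] by (auto simp: diagrams_def diagram_def) (meson le_less_trans less_le_trans)
qed

interpretation diagrams: finite_set_lattice diagrams
proof
  fix X Y assume X: "X \<in> diagrams" and Y: "Y \<in> diagrams"
  show "finite X" using X by (simp add: diagrams_def)
  show "X \<union> Y \<in> diagrams" "X \<inter> Y \<in> diagrams" using X Y by (auto simp: diagrams_def)
next
  fix X :: "(nat \<times> nat) set" assume X: "X \<in> diagrams" "X \<noteq> {}"
  \<comment> \<open>A cell with the largest coordinate sum is a corner, so the remaining cells are
    still closed downwards.\<close>
  let ?h = "\<lambda>p. fst p + snd p"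
  have fin: "finite X" using X by (simp add: diagrams_def)
  then have "Max (?h ` X) \<in> ?h ` X" using X by (intro Max_in) auto
  then obtain p where p: "p \<in> X" "Max (?h ` X) = ?h p" by blast
  have max: "?h q \<le> ?h p" if "q \<in> X" for q
    using Max_ge[of "?h ` X" "?h q"] fin that by (simp add: p(2))
  have "X - {p} \<in> diagrams"
    unfolding diagrams_def
  proof (intro CollectI conjI allI impI)
    fix c k c' k' assume ck: "(c, k) \<in> X - {p}" "c' \<le> c" "k' \<le> k"
    then have "(c', k') \<in> X" using diagrams_down[OF X(1)] by blast
    moreover have "(c', k') \<noteq> p" using ck max[of "(c, k)"] by auto
    ultimately show "(c', k') \<in> X - {p}" by simp
  qed (use fin in simp)
  then show "\<exists>x \<in> X. X - {x} \<in> diagrams" using p by blast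
qed

lemma finite_down_closed_nat:
  fixes S :: "nat set"
  assumes "finite S" "\<And>a b. \<lbrakk>a \<in> S; b \<le> a\<rbrakk> \<Longrightarrow> b \<in> S"
  shows "S = {..<card S}"
proof (cases "S = {}")
  case False
  have "S = {..Max S}"
    using Max_in[OF assms(1) False] assms by (auto intro: Max_ge)
  then have "card S = Suc (Max S)" by (metis card_atMost)
  with \<open>S = {..Max S}\<close> show ?thesis by (metis lessThan_Suc_atMost)
qed simp

lemma diagram_surj:
  assumes D: "D \<in> diagrams"
  obtains xs where "xs \<in> integer_partitions (card D)" "diagram xs = D"
proof -
  have fin: "finite D" using D by (simp add: diagrams_def)
  define row where "row k = card {c. (c, k) \<in> D}" for k
  define m where "m = card {k. (0, k) \<in> D}"
  have "finite {c. (c, k) \<in> D}" for k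
    by (rule finite_subset[of _ "fst ` D"]) (use fin in force)+
  then have row: "{c. (c, k) \<in> D} = {..<row k}" for k
    unfolding row_def using diagrams_down[OF D] by (intro finite_down_closed_nat) auto
  have "finite {k. (0, k) \<in> D}"
    by (rule finite_subset[of _ "snd ` D"]) (use fin in force)+
  then have m: "{k. (0, k) \<in> D} = {..<m}"
    unfolding m_def using diagrams_down[OF D] by (intro finite_down_closed_nat) auto
  \<comment> \<open>\<open>m\<close> is the height of column 0, so the listed rows are exactly the
    nonempty ones.\<close>
  let ?xs = "map row [0..<m]"
  have mono: "row l \<le> row k" if "k \<le> l" for k l
  proof -
    have "{c. (c, l) \<in> D} \<subseteq> {c. (c, k) \<in> D}" using diagrams_down[OF D] that by auto
    then show ?thesis by (simp add: row)
  qed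
  then have sorted: "sorted_wrt (\<ge>) ?xs" by (simp add: sorted_wrt_iff_nth_less)
  have D_iff: "(c, k) \<in> D \<longleftrightarrow> c < row k" "(0, k) \<in> D \<longleftrightarrow> k < m" for c k
    using row[of k] m by (auto simp: set_eq_iff)
  then have "(c, k) \<in> D \<longleftrightarrow> k < m \<and> c < row k" for c k
    by (metis gr_zeroI not_less_zero)
  then have eq: "diagram ?xs = D"
    using mem_diagram_iff[OF sorted] by auto
  moreover have "?xs \<in> integer_partitions (card D)"
    using sorted D_iff card_diagram(2)[of ?xs] by (auto simp: integer_partitions_def eq)
  ultimately show ?thesis using that by blast
qed

lemma bij_betw_diagram: "bij_betw diagram (integer_partitions n) (diagrams.level n)"
  unfolding bij_betw_def
proof (intro conjI subset_antisym subsetI)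
  show "inj_on diagram (integer_partitions n)" by (rule inj_onI) (rule inj_diagram)
  show "D \<in> diagrams.level n" if "D \<in> diagram ` integer_partitions n" for D
    using that diagram_in_diagrams card_diagram(2)
    by (auto simp: diagrams.level_def integer_partitions_def)
  show "D \<in> diagram ` integer_partitions n" if "D \<in> diagrams.level n" for D
    using that diagram_surj[of D] by (auto simp: diagrams.level_def)
qed

section \<open>Cell moves and diagrams that share all cells but one\<close>

lemma near_diagram_of_cell_move:
  assumes xs: "xs \<in> integer_partitions n" and move: "cell_move xs ys"
  shows "near (diagram xs) (diagram ys)"
proof -
  obtain i j where ij: "i < length xs" "j \<le> length xs" "i \<noteq> j" and ys: "ys = move_cell i j xs"
    using move by (auto simp: cell_move_def)
  let ?us = "xs @ [0]"
  \<comment> \<open>Stopping halfway, with the cell removed and not yet added, gives a list whose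
    diagram lies in both diagrams and has one cell less. The list may be unsorted, which
    \<open>diagram\<close> ignores.\<close>
  let ?ws = "?us[i := ?us ! i - 1]"
  let ?zs = "?ws[j := ?us ! j + 1]"
  have dys: "diagram ys = diagram ?zs" by (simp add: ys move_cell_def Let_def diagram_normalize_rows)
  \<comment> \<open>\<open>sum_list_update\<close> involves truncated subtraction, so the row losing
    a cell must be known to be nonempty.\<close>
  have "0 < ?us ! i" using xs ij by (auto simp: integer_partitions_def nth_append)
  moreover have "?us ! i \<le> sum_list ?us" by (rule member_le_sum_list, rule nth_mem) (use ij in simp_all)
  moreover have "?us ! i - 1 + sum_list ?us - ?us ! i = sum_list ?us - 1" using calculation by simp
  moreover have "sum_list ?ws = sum_list ?us + (?us ! i - 1) - ?us ! i"
    by (rule sum_list_update) (use ij in simp)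
  ultimately have ws: "Suc (sum_list ?ws) = sum_list ?us" by linarith
  have "sum_list ?zs = sum_list ?ws + (?us ! j + 1) - ?ws ! j"
    by (rule sum_list_update) (use ij in simp)
  then have zs: "sum_list ?zs = Suc (sum_list ?ws)" using ij by simp
  have "diagram ?ws \<subseteq> diagram ?us" "diagram ?ws \<subseteq> diagram ?zs"
    using ij by (auto intro!: diagram_mono simp: list_all2_conv_all_nth nth_list_update)
  then have "near (diagram ?us) (diagram ?zs)"
    by (rule near_if_common_subset[OF card_diagram(1)]) (simp_all only: card_diagram(2) ws zs)
  then show ?thesis by (simp add: dys diagram_append_0)
qed

lemma length_filter_update:
  "i < length xs \<Longrightarrow> length (filter P (xs[i := x])) + of_bool (P (xs ! i)) = length (filter P xs) + of_bool (P x)"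
proof (induction xs arbitrary: i)
  case (Cons y xs)
  show ?case
  proof (cases i)
    case (Suc k)
    then show ?thesis using Cons.IH[of k] Cons.prems by simp
  qed simp
qed simp

lemma column_diagram: "{k. (c, k) \<in> diagram xs} = {..<length (filter (\<lambda>r. c < r) xs)}"
  by (auto simp: diagram_def)

text \<open>One cell \<open>(c, i)\<close> leaves the diagram and one cell \<open>(c', j)\<close>
  enters it. That moving a cell from row \<open>i\<close> to row \<open>j\<close> has this effect is
  checked on column heights, so that the reordering of rows never has to be traced.\<close>

lemma cell_move_of_near_diagram:
  assumes xs: "xs \<in> integer_partitions n" and ys: "ys \<in> integer_partitions n"
    and near: "near (diagram xs) (diagram ys)" and ne: "xs \<noteq> ys"
  shows "cell_move xs ys"
proof -
  let ?D = "diagram xs" and ?E = "diagram ys" and ?us = "xs @ [0]"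
  let ?col = "\<lambda>zs c. length (filter (\<lambda>r. c < r) zs)"
  have "?D \<noteq> ?E" using inj_diagram[OF xs ys] ne by auto
  then have c: "card ?D = Suc (card (?D \<inter> ?E))" "card ?E = Suc (card (?D \<inter> ?E))"
    using card_Int_near[OF card_diagram(1) card_diagram(1) near] near by (auto simp: near_def)
  have "card (?D - ?E) = 1" "card (?E - ?D) = 1"
    using c card_Diff_subset_Int[of ?D ?E] card_Diff_subset_Int[of ?E ?D] card_diagram(1)
    by (auto simp: Int_commute)
  then obtain c i c' j where D: "?D - ?E = {(c, i)}" and E: "?E - ?D = {(c', j)}"
    by (auto simp: card_1_singleton_iff)
  note downD = diagrams_down[OF diagram_in_diagrams, of _ _ xs]
    and downE = diagrams_down[OF diagram_in_diagrams, of _ _ ys]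
  have mem: "(c, i) \<in> ?D" "(c, i) \<notin> ?E" "(c', j) \<in> ?E" "(c', j) \<notin> ?D" using D E by auto
  have inE: "p \<in> ?E" if "p \<in> ?D" "p \<noteq> (c, i)" for p using D that by blast
  have inD: "p \<in> ?D" if "p \<in> ?E" "p \<noteq> (c', j)" for p using E that by blast
  have Diff: "(b, k) \<in> ?E \<longleftrightarrow> ((b, k) \<in> ?D \<and> (b, k) \<noteq> (c, i)) \<or> (b, k) = (c', j)" for b k
    using inE inD mem by metis
  have D_iff: "(b, k) \<in> ?D \<longleftrightarrow> k < length xs \<and> b < xs ! k" for b k
    using xs by (intro mem_diagram_iff) (simp add: integer_partitions_def)
  \<comment> \<open>Within a common row the cell further to the left would belong to both diagrams
    by downward closure.\<close>
  have ij: "i \<noteq> j" using mem downD downE nle_le by metis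
  have i: "i < length xs" "c < xs ! i" using mem(1) D_iff by auto
  \<comment> \<open>\<open>(c, i)\<close> ends its row: a cell to its right would also lie in
    \<open>?E\<close> and force \<open>(c, i)\<close> into \<open>?E\<close>.\<close>
  have "(Suc c, i) \<notin> ?D" using inE[of "(Suc c, i)"] downE[of "Suc c" i c i] mem(2) by auto
  then have xi: "?us ! i = Suc c" using i D_iff by (simp add: nth_append)
  \<comment> \<open>Equality is the case of a new row, represented by the 0 appended in
    \<open>?us\<close>.\<close>
  have j: "j \<le> length xs"
  proof (rule ccontr)
    assume "\<not> j \<le> length xs"
    then have "(0, j - 1) \<notin> ?D" "j - 1 \<noteq> j" using D_iff by auto
    moreover have "(0, j - 1) \<in> ?E" using mem(3) by (rule downE) auto
    ultimately show False using inD[of "(0, j - 1)"] by simp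
  qed
  have "?us ! j \<le> c'" using mem(4) j D_iff by (auto simp: nth_append)
  moreover have "c' \<le> ?us ! j"
  proof (cases c')
    case (Suc b)
    have "(b, j) \<in> ?E" using mem(3) by (rule downE) (use Suc in auto)
    then have "(b, j) \<in> ?D" using inD Suc by simp
    then show ?thesis using D_iff Suc by (auto simp: nth_append)
  qed simp
  ultimately have xj: "?us ! j = c'" by simp
  let ?zs = "?us[i := c, j := Suc c']"
  have "?col ?zs b = ?col ys b" for b
  proof -
    have "?col (?us[i := c]) b + of_bool (b < Suc c) = ?col ?us b + of_bool (b < c)"
      using length_filter_update[of i ?us "\<lambda>r. b < r" c] i xi by simp
    moreover have "?col ?zs b + of_bool (b < c') = ?col (?us[i := c]) b + of_bool (b < Suc c')"
      using length_filter_update[of j "?us[i := c]" "\<lambda>r. b < r" "Suc c'"] j xj ij by simp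
    moreover have "?col ?us b = ?col xs b" by simp
    \<comment> \<open>In each column the diagrams agree once \<open>?E\<close> is given the lost
      cell and \<open>?D\<close> the gained one.\<close>
    moreover have "?col ys b + of_bool (b = c) = ?col xs b + of_bool (b = c')"
    proof -
      have "{k. (b, k) \<in> ?E} \<union> (if b = c then {i} else {}) = {k. (b, k) \<in> ?D} \<union> (if b = c' then {j} else {})"
        using Diff mem by auto
      then have eq: "{..<?col ys b} \<union> (if b = c then {i} else {}) = {..<?col xs b} \<union> (if b = c' then {j} else {})"
        by (simp only: column_diagram)
      have "b = c \<Longrightarrow> i \<notin> {..<?col ys b}" "b = c' \<Longrightarrow> j \<notin> {..<?col xs b}"
        using mem by (auto simp: diagram_def)
      then have "card ({..<?col ys b} \<union> (if b = c then {i} else {})) = ?col ys b + of_bool (b = c)"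
        "card ({..<?col xs b} \<union> (if b = c' then {j} else {})) = ?col xs b + of_bool (b = c')" by auto
      then show ?thesis using eq by metis
    qed
    ultimately show ?thesis by (auto simp: of_bool_def split: if_splits)
  qed
  then have "diagram ?zs = ?E" by (simp add: diagram_def)
  moreover have mv: "move_cell i j xs = normalize_rows ?zs"
    using xi xj by (simp add: move_cell_def Let_def)
  ultimately have "diagram (move_cell i j xs) = ?E" by (simp add: diagram_normalize_rows)
  moreover have "move_cell i j xs \<in> integer_partitions (sum_list ?zs)"
    unfolding mv by (rule normalize_rows_partition)
  ultimately have "ys = move_cell i j xs" using inj_diagram[OF ys] by metis
  then show ?thesis using i(1) j ij by (auto simp: cell_move_def)
qed

lemma partition_adj_iff:
  assumes "xs \<in> integer_partitions n" "ys \<in> integer_partitions n"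
  shows "partition_adj xs ys \<longleftrightarrow> xs \<noteq> ys \<and> near (diagram xs) (diagram ys)"
  unfolding partition_adj_def
  using assms near_diagram_of_cell_move cell_move_of_near_diagram near_sym by blast

lemma finite_integer_partitions: "finite (integer_partitions n)"
proof (rule finite_subset)
  have "length xs \<le> sum_list xs" if "\<forall>x \<in> set xs. 0 < x" for xs :: "nat list"
    using that by (induction xs) auto
  then show "integer_partitions n \<subseteq> {xs. set xs \<subseteq> {..n} \<and> length xs \<le> n}"
    by (auto simp: integer_partitions_def intro: member_le_sum_list)
  show "finite {xs. set xs \<subseteq> {..n} \<and> length xs \<le> n}" by (rule finite_lists_length_le) simp
qed

theorem proposition7p2:
  fixes n :: nat
  assumes "n \<ge> 1"
  shows "(\<forall>i::int. i \<noteq> 2 \<longrightarrow>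
            trivial_group (reduced_simplicial_homology i (partition_complex n)))
       \<and> (\<exists>r::nat. int r = complex_euler_char (partition_complex n) - 1
            \<and> reduced_simplicial_homology 2 (partition_complex n) \<cong> free_Abelian_group {..<r}
            \<and> abelian_rank (reduced_simplicial_homology 2 (partition_complex n)) = enat r)"
proof -
  \<comment> \<open>A positive \<open>n\<close> has a level below it, and \<open>[n]\<close> shows
    that there are vertices.\<close>
  obtain m where m: "n = Suc m" using assms by (cases n) auto
  have "[n] \<in> integer_partitions n" using assms by (simp add: integer_partitions_def)
  then interpret level_clique_complex diagrams "integer_partitions n" diagram m partition_adj
    using finite_integer_partitions bij_betw_diagram partition_adj_iff
    by unfold_locales (auto simp: m)
  show ?thesis using level_homology by (simp add: partition_complex_def)
qed

end
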